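(* Suppose that $s$ and $t$ are closed terms over $\mathcal{K}_1$ and that $s\sim_\alpha t$ for some ordinal $\alpha$. Then there is an $\alpha<\omega_1^{CK}$ such that $s\sim_\alpha t$. That is, $\mathrm{ord}(\mathcal{K}_1)\leq\omega_1^{CK}$.
   Context: For a pca $\mathcal{A}$ (set with partial application, associating to the left, with combinators $K$, $S$), closed terms are built from elements by application, and $s\simeq t$ means both undefined or both defined and equal. Relations $\sim_\alpha$ on closed terms: $s\sim_0 t$ iff $s\simeq t$; $s \sim_{\alpha+1} t$ iff $sx \sim_\alpha tx$ for all $x\in\mathcal{A}$; for limit $\alpha$, $s\sim_\alpha t$ iff $s\sim_\beta t$ for some $\beta<\alpha$. $\mathrm{ord}(\mathcal{A})$ is the least $\alpha$ with $\sim_\alpha=\sim_{\alpha+1}$. $\mathcal{K}_1$ is the pca on $\omega$ with $n\cdot m=\Phi_n(m)$ ($\Phi_n$ the $n$-th partial computable function). $\omega_1^{CK}$ is the least non-computable ordinal. *)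

theory Defs
  imports Main "HOL-Library.Nat_Bijection"
begin

unbundle cardinal_syntax

section \<open>Partial computable functions\<close>

text \<open>
  Programs for the unary partial recursive functions. Several arguments are passed through
  the Cantor pairing \<^const>\<open>prod_encode\<close>.
\<close>

datatype code =
    Zero | Succ | Left | Right
  | Pairing code code
  | Comp code code
  | Prec code code
  | Mu code

primrec run :: "code \<Rightarrow> nat \<Rightarrow> nat option" where
  "run Zero n = Some 0"
| "run Succ n = Some (Suc n)"
| "run Left n = Some (fst (prod_decode n))"
| "run Right n = Some (snd (prod_decode n))"
| "run (Pairing f g) n =
     Option.bind (run f n) (\<lambda>a. Option.bind (run g n) (\<lambda>b. Some (prod_encode (a, b))))"
| "run (Comp f g) n = Option.bind (run g n) (run f)"
| "run (Prec f g) n =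
     (case prod_decode n of (a, m) \<Rightarrow>
        rec_nat (run f a)
          (\<lambda>k r. Option.bind r (\<lambda>v. run g (prod_encode (a, prod_encode (k, v))))) m)"
| "run (Mu f) n =
     (let least_zero = (\<lambda>k. run f (prod_encode (n, k)) = Some 0 \<and>
                        (\<forall>j<k. \<exists>v. run f (prod_encode (n, j)) = Some (Suc v)))
      in if \<exists>k. least_zero k then Some (THE k. least_zero k) else None)"

text \<open>A Goedel numbering: every natural number is the number of exactly one program.\<close>

primrec number :: "code \<Rightarrow> nat" where
  "number Zero = 0"
| "number Succ = 1"
| "number Left = 2"
| "number Right = 3"
| "number (Pairing f g) = 4 * prod_encode (number f, number g) + 4"
| "number (Comp f g) = 4 * prod_encode (number f, number g) + 5"
| "number (Prec f g) = 4 * prod_encode (number f, number g) + 6"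
| "number (Mu f) = 4 * number f + 7"

lemma number_inject: "number c = number d \<Longrightarrow> c = d"
proof (induction c arbitrary: d)
  case Zero then show ?case by (cases d) simp_all
next
  case Succ then show ?case by (cases d) simp_all
next
  case Left then show ?case by (cases d) simp_all
next
  case Right then show ?case by (cases d) simp_all
next
  case (Pairing f g) then show ?case by (cases d; simp; presburger)
next
  case (Comp f g) then show ?case by (cases d; simp; presburger)
next
  case (Prec f g) then show ?case by (cases d; simp; presburger)
next
  case (Mu f) then show ?case by (cases d; simp; presburger)
qed

lemma number_surjective: "\<exists>c. number c = n"
proof (induction n rule: less_induct)
  case (less n)
  show ?case
  proof (cases "n < 4")
    case True
    then consider "n = 0" | "n = 1" | "n = 2" | "n = 3" by linarith
    then show ?thesis by cases (metis number.simps(1-4))+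
  next
    case False
    define q where "q = (n - 4) div 4"
    obtain a b where ab: "q = prod_encode (a, b)"
      by (metis prod_decode_inverse surj_pair)
    have "q < n" using False unfolding q_def by linarith
    moreover have "a \<le> q" "b \<le> q"
      unfolding ab by (rule le_prod_encode_1, rule le_prod_encode_2)
    ultimately obtain f g h where fgh: "number f = a" "number g = b" "number h = q"
      using less.IH by (metis le_less_trans)
    have "n = 4 * q + 4 \<or> n = 4 * q + 5 \<or> n = 4 * q + 6 \<or> n = 4 * q + 7"
      using False unfolding q_def by linarith
    then show ?thesis
      by (metis ab fgh number.simps(5-8))
  qed
qed

lemma bij_number: "bij number"
  by (metis bijI injI number_inject number_surjective surjI surj_def)

definition program :: "nat \<Rightarrow> code" where
  "program n = inv number n"

definition Phi :: "nat \<Rightarrow> nat \<Rightarrow> nat option" where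
  "Phi n m = run (program n) m"

definition computable_rel :: "nat rel \<Rightarrow> bool" where
  "computable_rel R \<longleftrightarrow>
     (\<exists>e. \<forall>x y. Phi e (prod_encode (x, y)) = Some (if (x, y) \<in> R then 1 else 0))"


section \<open>Ordinals\<close>

text \<open>
  Ordinals are well-orders \<^term>\<open>r\<close> up to order isomorphism \<open>=o\<close>, compared by \<open>\<le>o\<close> and \<open><o\<close>;
  the domain is \<^term>\<open>Field r\<close>, which need not be the whole type. An element \<^term>\<open>a\<close> of
  \<^term>\<open>Field r\<close> stands for the ordinal of its proper initial segment, \<open>below r a\<close>.
\<close>

definition below :: "'o rel \<Rightarrow> 'o \<Rightarrow> 'o rel" where
  "below r a = Restr r (underS r a)"

definition is_top :: "'o rel \<Rightarrow> 'o \<Rightarrow> bool" where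
  "is_top r m \<longleftrightarrow> m \<in> Field r \<and> (\<forall>a\<in>Field r. (a, m) \<in> r)"

definition osucc :: "'o rel \<Rightarrow> 'o option rel" where
  "osucc r = {(Some a, Some b) | a b. (a, b) \<in> r} \<union> {(x, None) | x. x \<in> insert None (Some ` Field r)}"

definition computable_ordinal :: "'o rel \<Rightarrow> bool" where
  "computable_ordinal r \<longleftrightarrow> (\<exists>c :: nat rel. Well_order c \<and> computable_rel c \<and> r =o c)"

text \<open>
  The least non-computable ordinal is countable, so it has a representative on \<^typ>\<open>nat\<close>;
  which representative is chosen is immaterial.
\<close>

definition omega1CK :: "nat rel" where
  "omega1CK = (SOME r. Well_order r \<and> \<not> computable_ordinal r \<and>
                 (\<forall>q :: nat rel. Well_order q \<and> \<not> computable_ordinal q \<longrightarrow> r \<le>o q))"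


section \<open>Closed terms and the relations indexed by ordinals\<close>

text \<open>
  A pca is given by its partial application, of type \<^typ>\<open>'a \<Rightarrow> 'a \<Rightarrow> 'a option\<close>; the
  combinators \<open>K\<close> and \<open>S\<close> play no role in the definitions below.
\<close>

datatype 'a closed_term = Elem 'a | App "'a closed_term" "'a closed_term"

primrec value_of :: "('a \<Rightarrow> 'a \<Rightarrow> 'a option) \<Rightarrow> 'a closed_term \<Rightarrow> 'a option" where
  "value_of app (Elem a) = Some a"
| "value_of app (App s t) =
     Option.bind (value_of app s) (\<lambda>a. Option.bind (value_of app t) (\<lambda>b. app a b))"

definition kleene_eq :: "('a \<Rightarrow> 'a \<Rightarrow> 'a option) \<Rightarrow> 'a closed_term \<Rightarrow> 'a closed_term \<Rightarrow> bool" where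
  "kleene_eq app s t \<longleftrightarrow> value_of app s = value_of app t"

text \<open>
  Recursion on the well-order: the empty one is zero, one with a top element \<open>m\<close> is the
  successor of \<open>below r m\<close>, and any other one is a limit. For each \<open>r\<close> exactly one rule can
  apply, so every rule is an equivalence.
\<close>

inductive sim :: "('a \<Rightarrow> 'a \<Rightarrow> 'a option) \<Rightarrow> 'o rel \<Rightarrow> 'a closed_term \<Rightarrow> 'a closed_term \<Rightarrow> bool"
  for app where
  zero: "kleene_eq app s t \<Longrightarrow> sim app {} s t"
| succ: "Well_order r \<Longrightarrow> is_top r m \<Longrightarrow>
           (\<And>x. sim app (below r m) (App s (Elem x)) (App t (Elem x))) \<Longrightarrow> sim app r s t"
| limit: "Well_order r \<Longrightarrow> r \<noteq> {} \<Longrightarrow> \<nexists>m. is_top r m \<Longrightarrow>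
           b \<in> Field r \<Longrightarrow> sim app (below r b) s t \<Longrightarrow> sim app r s t"

lemma is_top_unique: "Well_order r \<Longrightarrow> is_top r m \<Longrightarrow> is_top r m' \<Longrightarrow> m = m'"
  unfolding is_top_def order_on_defs by (meson antisymD)

lemma sim_zero_iff: "sim app {} s t \<longleftrightarrow> kleene_eq app s t"
  by (subst sim.simps) (auto simp: is_top_def)

lemma sim_succ_iff:
  assumes "Well_order r" and "is_top r m"
  shows "sim app r s t \<longleftrightarrow> (\<forall>x. sim app (below r m) (App s (Elem x)) (App t (Elem x)))"
  using assms by (subst sim.simps) (auto simp: is_top_def[of "{}"] dest: is_top_unique)

lemma sim_limit_iff:
  assumes "Well_order r" and "r \<noteq> {}" and "\<nexists>m. is_top r m"
  shows "sim app r s t \<longleftrightarrow> (\<exists>b\<in>Field r. sim app (below r b) s t)"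
  using assms by (subst sim.simps) auto

text \<open>
  Every \<open>q <o r\<close> is isomorphic to an initial segment of \<open>r\<close>, so for minimality it is enough
  to let \<open>q\<close> range over well-orders on the same type.
\<close>

definition is_least_stable :: "('a \<Rightarrow> 'a \<Rightarrow> 'a option) \<Rightarrow> 'o rel \<Rightarrow> bool" where
  "is_least_stable app r \<longleftrightarrow> Well_order r \<and> sim app r = sim app (osucc r) \<and>
     (\<forall>q :: 'o rel. Well_order q \<and> sim app q = sim app (osucc q) \<longrightarrow> r \<le>o q)"

text \<open>
  For infinite \<^typ>\<open>'a\<close> there are as many closed terms as elements, and the relations
  \<^term>\<open>sim app r\<close> increase with \<^term>\<open>r\<close>, so a representative on \<^typ>\<open>'a\<close> exists.
\<close>

definition pca_ord :: "('a \<Rightarrow> 'a \<Rightarrow> 'a option) \<Rightarrow> 'a rel" where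
  "pca_ord app = (SOME r. is_least_stable app r)"

definition K1 :: "nat \<Rightarrow> nat \<Rightarrow> nat option" where
  "K1 n m = Phi n m"

end

theory Submission imports Defs begin

text \<open>
  The relation \<open>s \<sim>\<^sub>\<alpha> t\<close> holds for some \<open>\<alpha>\<close> iff the tree of all argument sequences along which
  \<open>s\<close> and \<open>t\<close> stay different is well-founded, and then its rank is a possible \<open>\<alpha>\<close>. Being
  different is not decidable, but it is the conjunction of a semidecidable and a co-semidecidable
  condition. If the nodes also record the values of the terms and certificates for the
  computations, and the undefinedness of a value is tested only up to the length of the node, the
  tree becomes decidable. It is still well-founded, and it contains a copy of the original tree, so
  its Kleene-Brouwer order is a computable well-order that is long enough.
\<close>

section \<open>Computable functions and decidable predicates\<close>

text \<open>\<open>computable_rel\<close> demands a total decision procedure, also for pairs outside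
  the field, so an enumerable tree would not do. A false claim that a value is undefined survives
  only until the sequence is longer than a certificate refuting it. Hence no infinite path contains
  one, and the larger tree stays well-founded. The nodes without false claims pass the test at every
  length and form the copy of the original tree; the other nodes only make the order longer. No rank
  is computed: appending an entry moves down in the Kleene-Brouwer order, so induction along that
  order replaces the rank. The construction is not uniform: the values of the two given terms enter
  as constants and need not be computed. Since \<open>omega1CK\<close> is chosen among minimal
  representatives, a non-computable well-order of the natural numbers must be found first, by
  counting. The bound on the closure ordinal is the first claim applied to the successor of
  \<open>omega1CK\<close>.\<close>

lemma program_number: "program (number c) = c"
  unfolding program_def using bij_number by (simp add: bij_is_inj)

definition computable :: "(nat \<Rightarrow> nat) \<Rightarrow> bool" where
  "computable f \<longleftrightarrow> (\<exists>c. \<forall>n. run c n = Some (f n))"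

definition decidable :: "(nat \<Rightarrow> bool) \<Rightarrow> bool" where
  "decidable P \<longleftrightarrow> computable (\<lambda>n. if P n then 1 else 0)"

abbreviation pfst :: "nat \<Rightarrow> nat" where "pfst n \<equiv> fst (prod_decode n)"
abbreviation psnd :: "nat \<Rightarrow> nat" where "psnd n \<equiv> snd (prod_decode n)"

named_theorems computable_intros

lemma computable_comp: "computable f \<Longrightarrow> computable g \<Longrightarrow> computable (\<lambda>n. f (g n))"
proof -
  assume "computable f" "computable g"
  then obtain c d where "\<And>n. run c n = Some (f n)" "\<And>n. run d n = Some (g n)"
    unfolding computable_def by blast
  then have "\<forall>n. run (Comp c d) n = Some (f (g n))" by simp
  then show ?thesis unfolding computable_def by blast
qed

lemma computable_const [computable_intros]: "computable (\<lambda>n. c)"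
proof (induction c)
  case 0
  have "\<forall>n. run Zero n = Some 0" by simp
  then show ?case unfolding computable_def by blast
next
  case (Suc c)
  have "\<forall>n. run Succ n = Some (Suc n)" by simp
  then have "computable Suc" unfolding computable_def by blast
  from computable_comp[OF this Suc] show ?case .
qed

lemma computable_pair [computable_intros]:
  assumes "computable f" "computable g"
  shows "computable (\<lambda>n. prod_encode (f n, g n))"
proof -
  obtain c d where "\<And>n. run c n = Some (f n)" "\<And>n. run d n = Some (g n)"
    using assms unfolding computable_def by blast
  then have "\<forall>n. run (Pairing c d) n = Some (prod_encode (f n, g n))" by simp
  then show ?thesis unfolding computable_def by blast
qed

lemma computable_pfst [computable_intros]: "computable f \<Longrightarrow> computable (\<lambda>n. pfst (f n))"
  by (rule computable_comp[of pfst]) (auto simp: computable_def intro: exI[of _ Left])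

lemma computable_psnd [computable_intros]: "computable f \<Longrightarrow> computable (\<lambda>n. psnd (f n))"
  by (rule computable_comp[of psnd]) (auto simp: computable_def intro: exI[of _ Right])

lemma computable_Suc [computable_intros]: "computable f \<Longrightarrow> computable (\<lambda>n. Suc (f n))"
  by (rule computable_comp[of Suc]) (auto simp: computable_def intro: exI[of _ Succ])

lemma computable_id [computable_intros]: "computable (\<lambda>n. n)"
  \<comment> \<open>No basic program is the identity; unpairing a number and pairing it again
    returns it.\<close>
  unfolding computable_def by (rule exI[of _ "Comp Left (Pairing (Pairing Left Right) Zero)"]) simp

text \<open>The source of the arithmetic closure rules below: a function is first rewritten as a
  \<open>rec_nat\<close>. The assumption on h packs parameter, counter and previous value in the
  layout that \<open>Prec\<close> passes to its step program.\<close>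

lemma computable_rec_nat [computable_intros]:
  assumes b: "computable b" and m: "computable m"
    and h: "computable (\<lambda>z. h (pfst z) (pfst (psnd z)) (psnd (psnd z)))"
  shows "computable (\<lambda>n. rec_nat (b n) (h n) (m n))"
proof -
  obtain c d where c: "\<And>n. run c n = Some (b n)"
    and d: "\<And>z. run d z = Some (h (pfst z) (pfst (psnd z)) (psnd (psnd z)))"
    using b h unfolding computable_def by blast
  have "run (Prec c d) (prod_encode (n, k)) = Some (rec_nat (b n) (h n) k)" for n k
    by (induction k) (simp_all add: c d)
  then have "computable (\<lambda>z. rec_nat (b (pfst z)) (h (pfst z)) (psnd z))"
    unfolding computable_def by (metis prod_decode_inverse prod.collapse)
  from computable_comp[OF this computable_pair[OF computable_id m]] show ?thesis by simp
qed

text \<open>A conditional is a recursion of length 0 or 1 whose step ignores counter and previous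
  value.\<close>

lemma computable_if [computable_intros]:
  assumes "decidable P" "computable f" "computable g"
  shows "computable (\<lambda>n. if P n then f n else g n)"
proof -
  have "computable (\<lambda>n. rec_nat (g n) (\<lambda>_ _. f n) (if P n then 1 else 0))"
    using assms(1) unfolding decidable_def
    by (intro computable_rec_nat assms(3) computable_comp[OF assms(2)] computable_intros)
  also have "(\<lambda>n. rec_nat (g n) (\<lambda>_ _. f n) (if P n then 1 else 0)) = (\<lambda>n. if P n then f n else g n)"
    by (auto simp: fun_eq_iff)
  finally show ?thesis .
qed

lemma computable_add [computable_intros]:
  assumes "computable f" "computable g"
  shows "computable (\<lambda>n. f n + g n)"
proof -
  have "rec_nat a (\<lambda>_. Suc) b = a + b" for a b :: nat by (induction b) simp_all
  moreover have "computable (\<lambda>n. rec_nat (f n) (\<lambda>_ r. Suc r) (g n))"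
    by (intro computable_intros assms)
  ultimately show ?thesis by simp
qed

lemma computable_mult [computable_intros]:
  assumes "computable f" "computable g"
  shows "computable (\<lambda>n. f n * g n)"
proof -
  have "rec_nat 0 (\<lambda>_ r. r + a) b = a * b" for a b :: nat by (induction b) simp_all
  moreover have "computable (\<lambda>n. rec_nat 0 (\<lambda>_ r. r + f n) (g n))"
    by (intro computable_intros assms computable_comp[OF assms(1)])
  ultimately show ?thesis by simp
qed

lemma computable_diff [computable_intros]:
  assumes "computable f" "computable g"
  shows "computable (\<lambda>n. f n - g n)"
proof -
  have pred: "rec_nat 0 (\<lambda>k _. k) a = a - 1" for a :: nat by (cases a) simp_all
  have "rec_nat a (\<lambda>_ r. rec_nat 0 (\<lambda>k _. k) r) b = a - b" for a b :: nat
    by (induction b) (simp_all add: pred)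
  moreover have "computable (\<lambda>n. rec_nat (f n) (\<lambda>_ r. rec_nat 0 (\<lambda>k _. k) r) (g n))"
    by (intro computable_intros assms)
  ultimately show ?thesis by simp
qed

text \<open>The recursion rests on \<open>k - k div 2 = Suc k div 2\<close>.\<close>

lemma computable_half [computable_intros]:
  assumes "computable f"
  shows "computable (\<lambda>n. f n div 2)"
proof -
  have "rec_nat 0 (\<lambda>k r. k - r) a = a div 2" for a :: nat
  proof (induction a)
    case (Suc a)
    then show ?case by simp
  qed simp
  moreover have "computable (\<lambda>n. rec_nat 0 (\<lambda>k r. k - r) (f n))"
    by (intro computable_intros assms)
  ultimately show ?thesis by simp
qed

section \<open>Closure properties of decidable predicates\<close>

lemma decidable_eq_0: 
  assumes "computable f" shows "decidable (\<lambda>n. f n = 0)"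
proof -
  have "computable (\<lambda>n. 1 - f n)" by (intro computable_intros assms)
  also have "(\<lambda>n. 1 - f n) = (\<lambda>n. if f n = 0 then 1 else 0)" by (auto simp: fun_eq_iff)
  finally show ?thesis unfolding decidable_def .
qed

lemma decidable_True_False [computable_intros]: "decidable (\<lambda>n. b)"
  unfolding decidable_def by (rule computable_const)

lemma decidable_comp: "decidable P \<Longrightarrow> computable f \<Longrightarrow> decidable (\<lambda>n. P (f n))"
  unfolding decidable_def by (rule computable_comp)

lemma decidable_not [computable_intros]:
  assumes "decidable P" shows "decidable (\<lambda>n. \<not> P n)"
  using decidable_eq_0[OF assms[unfolded decidable_def]] by (simp split: if_splits)

lemma decidable_conj [computable_intros]:
  assumes "decidable P" "decidable Q" shows "decidable (\<lambda>n. P n \<and> Q n)"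
proof -
  have "computable (\<lambda>n. (if P n then 1 else 0) * (if Q n then 1 else 0))"
    using assms unfolding decidable_def by (rule computable_mult)
  also have "(\<lambda>n. (if P n then 1 else 0) * (if Q n then 1 else 0)) = (\<lambda>n. if P n \<and> Q n then 1 else 0 :: nat)"
    by (auto simp: fun_eq_iff)
  finally show ?thesis unfolding decidable_def .
qed

lemma decidable_disj [computable_intros]:
  assumes "decidable P" "decidable Q" shows "decidable (\<lambda>n. P n \<or> Q n)"
  using decidable_not[OF decidable_conj[OF decidable_not[OF assms(1)] decidable_not[OF assms(2)]]]
  by simp

lemma decidable_imp [computable_intros]:
  assumes "decidable P" "decidable Q" shows "decidable (\<lambda>n. P n \<longrightarrow> Q n)"
  using decidable_disj[OF decidable_not[OF assms(1)] assms(2)] by (simp only: imp_conv_disj)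

lemma decidable_le [computable_intros]:
  assumes "computable f" "computable g" shows "decidable (\<lambda>n. f n \<le> g n)"
  using decidable_eq_0[OF computable_diff[OF assms]] by simp

lemma decidable_less [computable_intros]:
  assumes "computable f" "computable g" shows "decidable (\<lambda>n. f n < g n)"
  using decidable_not[OF decidable_le[OF assms(2,1)]] by (simp add: not_le)

lemma decidable_eq [computable_intros]:
  assumes "computable f" "computable g" shows "decidable (\<lambda>n. f n = g n)"
proof -
  have "decidable (\<lambda>n. f n \<le> g n \<and> g n \<le> f n)"
    by (intro computable_intros assms)
  also have "(\<lambda>n. f n \<le> g n \<and> g n \<le> f n) = (\<lambda>n. f n = g n)" by auto
  finally show ?thesis .
qed

lemma decidable_ex_less [computable_intros]:
  assumes "computable f" "decidable (\<lambda>z. P (pfst z) (psnd z))"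
  shows "decidable (\<lambda>n. \<exists>i<f n. P n i)"
proof -
  have "rec_nat 0 (\<lambda>k r. if P n k then 1 else r) m = (if \<exists>i<m. P n i then 1 else 0 :: nat)" for n m
    by (induction m) (auto simp: less_Suc_eq)
  moreover have "computable (\<lambda>n. rec_nat 0 (\<lambda>k r. if P n k then 1 else r) (f n))"
    using decidable_comp[OF assms(2), of "\<lambda>z. prod_encode (pfst z, pfst (psnd z))"]
    by (intro computable_intros assms(1)) (simp add: computable_intros)
  ultimately show ?thesis unfolding decidable_def by simp
qed

lemma decidable_all_less [computable_intros]:
  assumes "computable f" "decidable (\<lambda>z. P (pfst z) (psnd z))"
  shows "decidable (\<lambda>n. \<forall>i<f n. P n i)"
  using decidable_not[OF decidable_ex_less[OF assms(1) decidable_not[OF assms(2)]]] by simp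

text \<open>Membership of z is the parity of \<open>D div 2 ^ z\<close>, obtained by halving z
  times; a number is odd iff it differs from twice its half.\<close>

lemma decidable_set_decode [computable_intros]:
  assumes "computable f" "computable g" shows "decidable (\<lambda>n. f n \<in> set_decode (g n))"
proof -
  have *: "rec_nat D (\<lambda>_ r. r div 2) z = D div 2 ^ z" for D z :: nat
    by (induction z) (simp_all add: div_mult2_eq[symmetric] mult.commute)
  have "decidable (\<lambda>n. \<not> 2 * (rec_nat (g n) (\<lambda>_ r. r div 2) (f n) div 2) = rec_nat (g n) (\<lambda>_ r. r div 2) (f n))"
    by (intro computable_intros assms)
  also have "(\<lambda>n. \<not> 2 * (rec_nat (g n) (\<lambda>_ r. r div 2) (f n) div 2) = rec_nat (g n) (\<lambda>_ r. r div 2) (f n))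
      = (\<lambda>n. f n \<in> set_decode (g n))"
    unfolding * set_decode_def by (simp add: fun_eq_iff) (metis dvd_triv_left even_two_times_div_two)
  finally show ?thesis .
qed

section \<open>Arithmetic of coded lists\<close>

definition code_drop :: "nat \<Rightarrow> nat \<Rightarrow> nat" where
  "code_drop i n = rec_nat n (\<lambda>_ r. psnd (r - 1)) i"

definition code_nth :: "nat \<Rightarrow> nat \<Rightarrow> nat" where
  "code_nth n i = pfst (code_drop i n - 1)"

text \<open>A nonempty list is coded as the successor of the pair of head and tail. The code 0 of
  the empty list is harmless, because \<open>0 - 1 = 0\<close> and 0 unpairs to two zeros, so that
  its tail is again empty.\<close>

lemma list_decode_psnd: "list_decode (psnd (n - 1)) = tl (list_decode n)"
proof (cases n)
  case 0
  have "prod_decode 0 = (0, 0)" by (simp add: prod_decode_def prod_decode_aux.simps[of 0 0])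
  then show ?thesis using 0 by simp
qed (simp split: prod.split)

lemma list_decode_drop: "list_decode (code_drop i n) = drop i (list_decode n)"
  unfolding code_drop_def by (induction i) (simp_all add: list_decode_psnd drop_Suc tl_drop del: One_nat_def)

lemma list_decode_eq_Nil: "list_decode n = [] \<longleftrightarrow> n = 0"
  by (metis list_decode.simps(1) list_decode_inverse)

lemma less_length_list_decode: "i < length (list_decode n) \<longleftrightarrow> code_drop i n \<noteq> 0"
  by (metis list_decode_drop list_decode_eq_Nil drop_eq_Nil not_le)

lemma list_decode_nth: "i < length (list_decode n) \<Longrightarrow> list_decode n ! i = code_nth n i"
proof -
  assume i: "i < length (list_decode n)"
  then obtain k where k: "code_drop i n = Suc k" using less_length_list_decode not0_implies_Suc by blast
  have "list_decode n ! i = hd (list_decode (code_drop i n))"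
    using i by (simp add: list_decode_drop hd_drop_conv_nth)
  then show ?thesis unfolding code_nth_def k by (simp split: prod.split)
qed

lemma length_list_decode_le: "length (list_decode n) \<le> n"
proof (induction n rule: less_induct)
  case (less n)
  show ?case
  proof (cases n)
    case (Suc k)
    then have "psnd k \<le> k" by (metis le_prod_encode_2 prod.collapse prod_decode_inverse)
    then show ?thesis using less[of "psnd k"] Suc by (auto split: prod.split)
  qed simp
qed

text \<open>The length is the number of k for which dropping k entries leaves something. Counting up
  to n finds all of them, since a list is never longer than its code.\<close>

lemma length_list_decode_eq_sum:
  "length (list_decode n) = rec_nat 0 (\<lambda>k r. if code_drop k n = 0 then r else Suc r) n"
proof -
  have "rec_nat 0 (\<lambda>k r. if code_drop k n = 0 then r else Suc r) m = min m (length (list_decode n))" for m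
  proof (induction m)
    case (Suc m)
    then show ?case using less_length_list_decode[of m n]
      by (cases "code_drop m n = 0") (simp_all add: min_def)
  qed simp
  then show ?thesis using length_list_decode_le[of n] by simp
qed

lemma computable_code_drop [computable_intros]:
  assumes "computable f" "computable g" shows "computable (\<lambda>n. code_drop (f n) (g n))"
  unfolding code_drop_def by (intro computable_intros assms)

lemma computable_code_nth [computable_intros]:
  assumes "computable f" "computable g" shows "computable (\<lambda>n. code_nth (f n) (g n))"
  unfolding code_nth_def by (intro computable_intros assms)

lemma computable_length [computable_intros]:
  assumes "computable f" shows "computable (\<lambda>n. length (list_decode (f n)))"
proof -
  have "computable (\<lambda>n. rec_nat 0 (\<lambda>k r. if code_drop k n = 0 then r else Suc r) n)"
    by (intro computable_intros)
  then have "computable (\<lambda>n. length (list_decode n))"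
    by (simp only: length_list_decode_eq_sum)
  from computable_comp[OF this assms] show ?thesis .
qed

lemma computable_relI:
  assumes "decidable (\<lambda>n. (pfst n, psnd n) \<in> R)" shows "computable_rel R"
proof -
  obtain c where "\<And>n. run c n = Some (if (pfst n, psnd n) \<in> R then 1 else 0)"
    using assms unfolding decidable_def computable_def by blast
  then show ?thesis unfolding computable_rel_def Phi_def
    by (intro exI[of _ "number c"]) (simp add: program_number)
qed

lemma computable_relD:
  assumes "computable_rel R" "computable f" "computable g"
  shows "decidable (\<lambda>n. (f n, g n) \<in> R)"
proof -
  obtain e where e: "\<And>x y. Phi e (prod_encode (x, y)) = Some (if (x, y) \<in> R then 1 else 0)"
    using assms(1) unfolding computable_rel_def by blast
  have "\<forall>n. run (program e) n = Some (if (pfst n, psnd n) \<in> R then 1 else 0)"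
    using e unfolding Phi_def by (metis prod_decode_inverse prod.collapse)
  then have "decidable (\<lambda>n. (pfst n, psnd n) \<in> R)" unfolding decidable_def computable_def by blast
  from decidable_comp[OF this computable_pair[OF assms(2,3)]] show ?thesis by simp
qed

section \<open>The relations indexed by ordinals\<close>

lemma Field_below: "Well_order r \<Longrightarrow> Field (below r a) = underS r a"
  unfolding below_def by (auto simp: Field_def underS_def order_on_defs refl_on_def)

lemma Well_order_below: "Well_order r \<Longrightarrow> Well_order (below r a)"
  unfolding below_def by (rule Well_order_Restr)

lemma below_ordLess: "Well_order r \<Longrightarrow> a \<in> Field r \<Longrightarrow> below r a <o r"
  unfolding below_def by (rule underS_Restr_ordLess) auto

lemma below_below:
  assumes "Well_order r" "(b, a) \<in> r" "b \<noteq> a"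
  shows "below (below r a) b = below r b"
proof -
  have sub: "underS r b \<subseteq> underS r a"
    using underS_incr[OF _ _ assms(2)] assms(1) unfolding order_on_defs by blast
  have "x \<in> underS (below r a) b \<longleftrightarrow> x \<in> underS r b" for x
    using sub assms(2,3) by (auto simp: below_def underS_def[of _ b] underS_def[of r a])
  then have "underS (below r a) b = underS r b" by blast
  then show ?thesis using Restr_subset[OF sub] by (simp add: below_def)
qed

lemma below_mem_underS:
  assumes "Well_order r" "b \<in> Field (below r a)"
  shows "b \<in> Field r" "(b, a) \<in> r" "b \<noteq> a" "below (below r a) b = below r b"
proof -
  have b: "b \<in> underS r a" using assms by (simp add: Field_below)
  then show ba: "(b, a) \<in> r" "b \<noteq> a" by (simp_all add: underS_def)
  then show "b \<in> Field r" by (simp add: FieldI1)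
  show "below (below r a) b = below r b" using assms(1) ba by (rule below_below)
qed

lemma kleene_eq_App: "kleene_eq app s t \<Longrightarrow> kleene_eq app (App s u) (App t u)"
  unfolding kleene_eq_def by simp

text \<open>This removes the case distinction between zero, successors and limits.\<close>

lemma sim_iff:
  assumes "Well_order r"
  shows "sim app r s t \<longleftrightarrow> kleene_eq app s t \<or>
           (\<exists>a\<in>Field r. \<forall>x. sim app (below r a) (App s (Elem x)) (App t (Elem x)))"
  using assms
proof (induction r arbitrary: s t rule: wf_induct_rule[OF wf_ordLess])
  case (1 r)
  have IH: "sim app (below r b) s t \<longleftrightarrow> kleene_eq app s t \<or>
      (\<exists>a\<in>Field (below r b). \<forall>x. sim app (below r a) (App s (Elem x)) (App t (Elem x)))"
    if "b \<in> Field r" for b s t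
    using 1(1)[OF below_ordLess[OF 1(2) that] Well_order_below[OF 1(2)], of s t]
    by (simp add: below_mem_underS(4)[OF 1(2)])
  \<comment> \<open>Monotonicity among the segments of r itself follows from the induction
    hypothesis: a witness for the smaller segment is one for the larger.\<close>
  have sub: "sim app (below r b) s t"
    if "sim app (below r a) s t" "(a, b) \<in> r" for a b s t
  proof -
    have ab: "a \<in> Field r" "b \<in> Field r" using that(2) by (auto simp: Field_def)
    have "Field (below r a) \<subseteq> Field (below r b)"
      using underS_incr[OF _ _ that(2)] 1(2) unfolding Field_below[OF 1(2)] order_on_defs by blast
    then show ?thesis using IH[OF ab(1)] IH[OF ab(2)] that(1) by blast
  qed
  consider "r = {}" | m where "is_top r m" | "r \<noteq> {}" "\<nexists>m. is_top r m" by blast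
  then show ?case
  proof cases
    case 1
    then show ?thesis by (simp add: sim_zero_iff)
  next
    case (2 m)
    have m: "m \<in> Field r" using 2 unfolding is_top_def by blast
    have "sim app (below r m) (App s (Elem x)) (App t (Elem x))" if "kleene_eq app s t" for x
      using IH[OF m] kleene_eq_App[OF that] by blast
    moreover have "(a, m) \<in> r" if "a \<in> Field r" for a using 2 that unfolding is_top_def by blast
    ultimately show ?thesis unfolding sim_succ_iff[OF 1(2) 2] using m sub by blast
  next
    case 3
    \<comment> \<open>Without a top element each a lies strictly below some b, so a witness in r is
      already a witness in a proper segment.\<close>
    have lim: "\<exists>b\<in>Field r. a \<in> Field (below r b)" if a: "a \<in> Field r" for a
    proof -
      obtain b where "b \<in> Field r" "(b, a) \<notin> r" using 3(2) a unfolding is_top_def by blast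
      then have "(a, b) \<in> r" "a \<noteq> b"
        using 1(2) a unfolding order_on_defs total_on_def refl_on_def by (metis, metis)
      then show ?thesis using \<open>b \<in> Field r\<close> by (auto simp: Field_below[OF 1(2)] underS_def)
    qed
    obtain b where b: "b \<in> Field r" using 3(1) by (auto simp: Field_def)
    show ?thesis unfolding sim_limit_iff[OF 1(2) 3]
    proof
      assume "\<exists>b\<in>Field r. sim app (below r b) s t"
      then show "kleene_eq app s t \<or> (\<exists>a\<in>Field r. \<forall>x. sim app (below r a) (App s (Elem x)) (App t (Elem x)))"
        using IH below_mem_underS(1)[OF 1(2)] by blast
    next
      assume "kleene_eq app s t \<or> (\<exists>a\<in>Field r. \<forall>x. sim app (below r a) (App s (Elem x)) (App t (Elem x)))"
      then show "\<exists>b\<in>Field r. sim app (below r b) s t"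
      proof
        assume "kleene_eq app s t"
        then show ?thesis using IH[OF b] b by blast
      next
        assume "\<exists>a\<in>Field r. \<forall>x. sim app (below r a) (App s (Elem x)) (App t (Elem x))"
        then obtain a c where "\<forall>x. sim app (below r a) (App s (Elem x)) (App t (Elem x))"
          "c \<in> Field r" "a \<in> Field (below r c)" using lim by blast
        then show ?thesis using IH[OF \<open>c \<in> Field r\<close>] by blast
      qed
    qed
  qed
qed

text \<open>The image of f need not be an initial segment. By \<open>sim_iff\<close> a witness a may
  be replaced by \<open>f a\<close>, and f restricts to a strictly monotone map between the segments
  below them.\<close>

lemma sim_mono_fun:
  assumes "Well_order q" "Well_order r" "f ` Field q \<subseteq> Field r"
    and "\<And>a b. (a, b) \<in> q \<Longrightarrow> a \<noteq> b \<Longrightarrow> (f a, f b) \<in> r \<and> f a \<noteq> f b"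
    and "sim app q s t"
  shows "sim app r s t"
  using assms
proof (induction q arbitrary: r s t rule: wf_induct_rule[OF wf_ordLess])
  case (1 q)
  consider "kleene_eq app s t" |
    a where "a \<in> Field q" "\<And>x. sim app (below q a) (App s (Elem x)) (App t (Elem x))"
    using "1.prems" sim_iff by metis
  then show ?case
  proof cases
    case 1
    then show ?thesis using sim_iff "1.prems"(2) by metis
  next
    case (2 a)
    have "sim app (below r (f a)) (App s (Elem x)) (App t (Elem x))" for x
    proof (rule "1.IH"[OF below_ordLess[OF "1.prems"(1) 2(1)] _ _ _ _ 2(2)])
      show "f ` Field (below q a) \<subseteq> Field (below r (f a))"
        using "1.prems"(1,2,4) by (auto simp: Field_below underS_def)
      fix b c assume "(b, c) \<in> below q a" "b \<noteq> c"
      then have "(b, c) \<in> q" "b \<in> underS q a" "c \<in> underS q a" by (auto simp: below_def)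
      then show "(f b, f c) \<in> below r (f a) \<and> f b \<noteq> f c"
        using "1.prems"(4) \<open>b \<noteq> c\<close> by (auto simp: below_def underS_def)
    qed (rule "1.prems" Well_order_below)+
    moreover have "f a \<in> Field r" using "1.prems"(3) 2(1) by blast
    ultimately show ?thesis using sim_iff "1.prems"(2) by metis
  qed
qed

lemma sim_mono:
  assumes "q \<le>o r" "sim app q s t"
  shows "sim app r s t"
proof -
  obtain f where "Well_order q" "Well_order r" "embed q r f"
    using assms(1) unfolding ordLeq_def by blast
  note f = this
  have "f ` Field q \<subseteq> Field r" using f embed_Field by blast
  moreover have "compat q r f" using f(3) by (rule embed_compat)
  moreover have "inj_on f (Field q)" using f(1,3) by (rule embed_inj_on)
  ultimately have "(f a, f b) \<in> r \<and> f a \<noteq> f b" if "(a, b) \<in> q" "a \<noteq> b" for a b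
    using that unfolding compat_def by (auto dest: inj_onD FieldI1 FieldI2)
  with \<open>f ` Field q \<subseteq> Field r\<close> show ?thesis by (rule sim_mono_fun[OF f(1,2) _ _ assms(2)])
qed

text \<open>Every argument leads to a strictly smaller ordinal unless the terms are already Kleene
  equal, so no sequence f can keep them different forever.\<close>

lemma sim_eventually_kleene_eq:
  assumes "Well_order r" "sim app r s t"
  shows "\<exists>n. kleene_eq app (foldl (\<lambda>u x. App u (Elem x)) s (map f [0..<n]))
                           (foldl (\<lambda>u x. App u (Elem x)) t (map f [0..<n]))"
  using assms
proof (induction r arbitrary: s t f rule: wf_induct_rule[OF wf_ordLess])
  case (1 r)
  consider "kleene_eq app s t" |
    a where "a \<in> Field r" "\<And>x. sim app (below r a) (App s (Elem x)) (App t (Elem x))"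
    using "1.prems" sim_iff by metis
  then show ?case
  proof cases
    case 1
    then show ?thesis by (intro exI[of _ 0]) simp
  next
    case (2 a)
    from "1.IH"[OF below_ordLess[OF "1.prems"(1) 2(1)] Well_order_below[OF "1.prems"(1)] 2(2)[of "f 0"], of "\<lambda>n. f (Suc n)"]
    obtain n where "kleene_eq app
        (foldl (\<lambda>u x. App u (Elem x)) (App s (Elem (f 0))) (map (\<lambda>n. f (Suc n)) [0..<n]))
        (foldl (\<lambda>u x. App u (Elem x)) (App t (Elem (f 0))) (map (\<lambda>n. f (Suc n)) [0..<n]))" by blast
    then show ?thesis by (intro exI[of _ "Suc n"]) (simp add: map_upt_Suc del: upt_Suc)
  qed
qed

section \<open>The least non-computable ordinal\<close>

lemma computable_ordinal_ordIso:
  "r =o r' \<Longrightarrow> computable_ordinal r' \<Longrightarrow> computable_ordinal r"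
  unfolding computable_ordinal_def by (meson ordIso_transitive)

lemma ordIso_below_eq:
  assumes "Well_order r" "a \<in> Field r" "b \<in> Field r" "below r a =o below r b"
  shows "a = b"
proof (rule ccontr)
  have less: "below r x <o below r y" if "(x, y) \<in> r" "x \<noteq> y" for x y
  proof -
    have "x \<in> Field (below r y)" using that assms(1) by (simp add: Field_below underS_def)
    from below_ordLess[OF Well_order_below[OF assms(1)] this] show ?thesis
      using below_below[OF assms(1) that] by simp
  qed
  assume "a \<noteq> b"
  then have "(a, b) \<in> r \<or> (b, a) \<in> r"
    using assms(1-3) unfolding order_on_defs total_on_def by blast
  then have "below r a <o below r b \<or> below r b <o below r a"
    using less \<open>a \<noteq> b\<close> by auto
  then show False using assms(4) not_ordLess_ordIso ordIso_symmetric by blast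
qed

text \<open>
  There are only countably many programs, but uncountably many countable ordinals, namely the
  proper initial segments of the first uncountable cardinal.
\<close>

lemma ex_not_computable_ordinal:
  "\<exists>r :: nat rel. Well_order r \<and> \<not> computable_ordinal r"
proof (rule ccontr)
  assume "\<nexists>r :: nat rel. Well_order r \<and> \<not> computable_ordinal r"
  then have all: "computable_ordinal r" if "Well_order r" for r :: "nat rel" using that by blast
  define k :: "nat set rel" where "k = cardSuc natLeq"
  have k: "Card_order k" unfolding k_def by (simp add: cardSuc_Card_order natLeq_Card_order)
  then have wo: "Well_order k" unfolding card_order_on_def by blast
  define rel_of where "rel_of e = {(x, y). Phi e (prod_encode (x, y)) = Some 1}" for e
  have rel_of: "\<exists>e. c = rel_of e" if c: "computable_rel c" for c :: "nat rel"
  proof -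
    obtain e where "\<And>x y. Phi e (prod_encode (x, y)) = Some (if (x, y) \<in> c then 1 else 0)"
      using c unfolding computable_rel_def by blast
    then have "c = rel_of e" by (simp add: rel_of_def)
    then show ?thesis ..
  qed
  have "\<exists>e. below k a =o rel_of e" if a: "a \<in> Field k" for a
  proof -
    have "|underS k a| <o k" using k a by (rule card_of_underS)
    then have "|underS k a| \<le>o natLeq"
      unfolding k_def cardSuc_ordLeq_ordLess[OF natLeq_Card_order card_of_Card_order] .
    then have "|underS k a| \<le>o |UNIV :: nat set|"
      using ordIso_symmetric[OF card_of_nat] by (rule ordLeq_ordIso_trans)
    then obtain f :: "nat set \<Rightarrow> nat" where f: "inj_on f (Field (below k a))"
      unfolding Field_below[OF wo] card_of_ordLeq[symmetric] by blast
    note wo' = Well_order_below[OF wo, of a]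
    have "computable_ordinal (dir_image (below k a) f)"
      using wo' f by (intro all Well_order_dir_image)
    with dir_image_ordIso[OF wo' f] have "computable_ordinal (below k a)"
      by (rule computable_ordinal_ordIso)
    then show ?thesis unfolding computable_ordinal_def using rel_of by blast
  qed
  then obtain e where e: "\<And>a. a \<in> Field k \<Longrightarrow> below k a =o rel_of (e a)" by metis
  \<comment> \<open>The program fixes the order type of its relation, and different segments of a
    well-order have different types; so k would be countable.\<close>
  have "inj_on e (Field k)"
  proof (rule inj_onI)
    fix a b assume ab: "a \<in> Field k" "b \<in> Field k" "e a = e b"
    have "below k a =o rel_of (e b)" using e[OF ab(1)] ab(3) by simp
    from ordIso_transitive[OF this ordIso_symmetric[OF e[OF ab(2)]]]
    show "a = b" by (rule ordIso_below_eq[OF wo ab(1,2)])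
  qed
  then have "|Field k| \<le>o |UNIV :: nat set|" unfolding card_of_ordLeq[symmetric] by blast
  from ordIso_ordLeq_trans[OF ordIso_symmetric[OF card_of_Field_ordIso[OF k]]
      ordLeq_ordIso_trans[OF this card_of_nat]]
  have "k \<le>o natLeq" .
  moreover have "natLeq <o k" unfolding k_def by (simp add: cardSuc_greater natLeq_Card_order)
  ultimately show False using not_ordLess_ordLeq by blast
qed

text \<open>This shows that the choices in \<open>omega1CK\<close> and in \<open>pca_ord\<close> are
  not vacuous.\<close>

lemma ex_least_Well_order:
  fixes P :: "'o rel \<Rightarrow> bool"
  assumes "Well_order q" "P q"
  shows "\<exists>r. Well_order r \<and> P r \<and> (\<forall>q. Well_order q \<and> P q \<longrightarrow> r \<le>o q)"
proof -
  obtain r where "r \<in> {r. Well_order r \<and> P r}"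
    and min: "\<And>q. (q, r) \<in> ordLess \<Longrightarrow> q \<notin> {r. Well_order r \<and> P r}"
    using wfE_min[OF wf_ordLess, of q "{r. Well_order r \<and> P r}"] assms by blast
  then have "r \<le>o q" if "Well_order q" "P q" for q
    using that ordLess_or_ordLeq[of q r] by blast
  with \<open>r \<in> _\<close> show ?thesis by blast
qed

lemma omega1CK:
  shows Well_order_omega1CK: "Well_order omega1CK"
    and not_computable_omega1CK: "\<not> computable_ordinal omega1CK"
proof -
  obtain q :: "nat rel" where "Well_order q" "\<not> computable_ordinal q"
    using ex_not_computable_ordinal by blast
  from ex_least_Well_order[of q "\<lambda>r. \<not> computable_ordinal r", OF this]
  obtain r :: "nat rel" where "Well_order r \<and> \<not> computable_ordinal r \<and>
      (\<forall>q :: nat rel. Well_order q \<and> \<not> computable_ordinal q \<longrightarrow> r \<le>o q)" by blast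
  from someI[of "\<lambda>r. Well_order r \<and> \<not> computable_ordinal r \<and>
      (\<forall>q :: nat rel. Well_order q \<and> \<not> computable_ordinal q \<longrightarrow> r \<le>o q)", OF this]
  show "Well_order omega1CK" "\<not> computable_ordinal omega1CK"
    unfolding omega1CK_def by blast+
qed

lemma computable_rel_below:
  assumes "computable_rel c"
  shows "computable_rel (below c a)"
proof (rule computable_relI)
  have "decidable (\<lambda>n. (pfst n, psnd n) \<in> c \<and> (\<not> pfst n = a \<and> (pfst n, a) \<in> c) \<and>
      (\<not> psnd n = a \<and> (psnd n, a) \<in> c))"
    by (intro computable_intros computable_relD[OF assms])
  then show "decidable (\<lambda>n. (pfst n, psnd n) \<in> below c a)"
    by (simp add: below_def underS_def mem_Times_iff)
qed

text \<open>Proper initial segments of a computable order are computable, being cut out by one fixed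
  number. If \<open>omega1CK\<close> were at most c, it would be isomorphic to c or to such a
  segment.\<close>

lemma computable_Well_order_ordLess_omega1CK:
  assumes "Well_order c" "computable_rel c"
  shows "c <o omega1CK"
proof (rule ccontr)
  assume "\<not> c <o omega1CK"
  then have "omega1CK \<le>o c"
    using assms(1) Well_order_omega1CK ordLess_or_ordLeq by blast
  then consider "omega1CK =o c" | "omega1CK <o c" using ordLeq_iff_ordLess_or_ordIso by blast
  then have "computable_ordinal omega1CK"
  proof cases
    case 1
    then show ?thesis unfolding computable_ordinal_def using assms by blast
  next
    case 2
    then obtain a where "omega1CK =o below c a"
      unfolding below_def ordLess_iff_ordIso_Restr[OF assms(1) Well_order_omega1CK] by blast
    then show ?thesis unfolding computable_ordinal_def
      using Well_order_below[OF assms(1)] computable_rel_below[OF assms(2)] by blast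
  qed
  then show False using not_computable_omega1CK by contradiction
qed

section \<open>Certificates for computations\<close>

definition triple :: "code \<Rightarrow> nat \<Rightarrow> nat \<Rightarrow> nat" where
  "triple c x y = prod_encode (number c, prod_encode (x, y))"

text \<open>One evaluation rule, with its premises looked up in \<open>A\<close>. Asking this of
  every fact in a set replaces derivation trees by a local condition that bounded search can check.
  In the clause for \<open>Mu\<close> the arguments below y also need positive evidence, a recorded
  nonzero value.\<close>

fun justified :: "nat set \<Rightarrow> code \<Rightarrow> nat \<Rightarrow> nat \<Rightarrow> bool" where
  "justified A Zero x y \<longleftrightarrow> y = 0"
| "justified A Succ x y \<longleftrightarrow> y = Suc x"
| "justified A Left x y \<longleftrightarrow> y = pfst x"
| "justified A Right x y \<longleftrightarrow> y = psnd x"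
| "justified A (Pairing f g) x y \<longleftrightarrow>
     (\<exists>a b. y = prod_encode (a, b) \<and> triple f x a \<in> A \<and> triple g x b \<in> A)"
| "justified A (Comp f g) x y \<longleftrightarrow> (\<exists>a. triple g x a \<in> A \<and> triple f a y \<in> A)"
| "justified A (Prec f g) x y \<longleftrightarrow>
     (case psnd x of
        0 \<Rightarrow> triple f (pfst x) y \<in> A
      | Suc k \<Rightarrow> \<exists>v. triple (Prec f g) (prod_encode (pfst x, k)) v \<in> A \<and>
                      triple g (prod_encode (pfst x, prod_encode (k, v))) y \<in> A)"
| "justified A (Mu f) x y \<longleftrightarrow>
     triple f (prod_encode (x, y)) 0 \<in> A \<and> (\<forall>j<y. \<exists>v. triple f (prod_encode (x, j)) (Suc v) \<in> A)"

definition certificate :: "nat set \<Rightarrow> bool" where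
  "certificate A \<longleftrightarrow> (\<forall>c x y. triple c x y \<in> A \<longrightarrow> justified A c x y)"

lemma run_Mu_iff:
  "run (Mu f) x = Some y \<longleftrightarrow>
     run f (prod_encode (x, y)) = Some 0 \<and> (\<forall>j<y. \<exists>v. run f (prod_encode (x, j)) = Some (Suc v))"
proof -
  define least :: "nat \<Rightarrow> bool" where "least k \<longleftrightarrow> run f (prod_encode (x, k)) = Some 0 \<and>
      (\<forall>j<k. \<exists>v. run f (prod_encode (x, j)) = Some (Suc v))" for k
  have unique: "k = k'" if "least k" "least k'" for k k'
  proof (rule linorder_cases[of k k'])
    assume "k < k'"
    then show ?thesis using that unfolding least_def by fastforce
  next
    assume "k' < k"
    then show ?thesis using that unfolding least_def by fastforce
  qed
  then have "(THE k. least k) = k" if "least k" for k using that by (intro the_equality)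
  then have "(if \<exists>k. least k then Some (THE k. least k) else None) = Some y \<longleftrightarrow> least y"
    using unique by auto
  moreover have "run (Mu f) x = (if \<exists>k. least k then Some (THE k. least k) else None)"
    unfolding least_def run.simps Let_def ..
  ultimately show ?thesis unfolding least_def by simp
qed

lemma run_Prec_Suc:
  assumes "psnd x = Suc k"
  shows "run (Prec f g) x =
     Option.bind (run (Prec f g) (prod_encode (pfst x, k)))
       (\<lambda>v. run g (prod_encode (pfst x, prod_encode (k, v))))"
proof -
  obtain a where "x = prod_encode (a, Suc k)"
    using assms by (metis prod.collapse prod_decode_inverse)
  then show ?thesis by simp
qed

lemma run_Prec_0:
  assumes "psnd x = 0"
  shows "run (Prec f g) x = run f (pfst x)"
proof -
  obtain a where "x = prod_encode (a, 0)"
    using assms by (metis prod.collapse prod_decode_inverse)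
  then show ?thesis by simp
qed

text \<open>
  A certificate is allowed to be circular: in every rule either the program or the recursion
  argument becomes smaller, so no order on the facts is needed.
\<close>

lemma certificate_sound:
  assumes "certificate A" "triple c x y \<in> A"
  shows "run c x = Some y"
  using assms(2)
proof (induction c arbitrary: x y)
  case (Pairing f g)
  then have "justified A (Pairing f g) x y" using assms(1) unfolding certificate_def by blast
  then show ?case using Pairing.IH by auto
next
  case (Comp f g)
  then have "justified A (Comp f g) x y" using assms(1) unfolding certificate_def by blast
  then show ?case using Comp.IH by auto
next
  case (Prec f g)
  \<comment> \<open>One premise is about \<open>Prec f g\<close> itself and escapes the structural
    induction; its recursion argument is smaller.\<close>
  have "run (Prec f g) x = Some y" if "psnd x = m" "triple (Prec f g) x y \<in> A" for m
    using that
  proof (induction m arbitrary: x y)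
    case 0
    then have "justified A (Prec f g) x y" using assms(1) unfolding certificate_def by blast
    then have "triple f (pfst x) y \<in> A" using 0 by simp
    then show ?case using Prec.IH(1) run_Prec_0[OF 0(1)] by (simp del: run.simps)
  next
    case (Suc m)
    then have "justified A (Prec f g) x y" using assms(1) unfolding certificate_def by blast
    then obtain v where "triple (Prec f g) (prod_encode (pfst x, m)) v \<in> A"
      "triple g (prod_encode (pfst x, prod_encode (m, v))) y \<in> A" using Suc.prems by auto
    then have "run (Prec f g) (prod_encode (pfst x, m)) = Some v"
      "run g (prod_encode (pfst x, prod_encode (m, v))) = Some y"
      using Prec.IH(2) Suc.IH by (simp_all del: run.simps)
    then show ?case unfolding run_Prec_Suc[OF Suc.prems(1)] by (simp del: run.simps)
  qed
  then show ?case using Prec.prems by blast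
next
  case (Mu f)
  then have "justified A (Mu f) x y" using assms(1) unfolding certificate_def by blast
  then show ?case unfolding run_Mu_iff using Mu.IH by auto
qed (use assms(1) in \<open>unfold certificate_def, (metis justified.simps(1-4) run.simps(1-4))+\<close>)

lemma justified_mono:
  assumes "justified A c x y" "A \<subseteq> B"
  shows "justified B c x y"
proof (cases c)
  case (Prec f g)
  with assms show ?thesis by (cases "psnd x") auto
next
  case (Mu f)
  with assms show ?thesis by (simp add: subset_iff) blast
qed (use assms in auto)

lemma triple_eq_iff: "triple c x y = triple d u v \<longleftrightarrow> c = d \<and> x = u \<and> y = v"
  unfolding triple_def by (auto simp: prod_encode_eq dest: number_inject)

lemma certificate_Union: "(\<And>A. A \<in> S \<Longrightarrow> certificate A) \<Longrightarrow> certificate (\<Union>S)"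
  unfolding certificate_def by (metis UnionE Union_upper justified_mono)

definition certified :: "code \<Rightarrow> nat \<Rightarrow> nat \<Rightarrow> bool" where
  "certified c x y \<longleftrightarrow> (\<exists>A. finite A \<and> certificate A \<and> triple c x y \<in> A)"

text \<open>T lists the premises of one rule. Justification is monotone, so the union of their
  certificates is a certificate, and the conclusion can be added to it.\<close>

lemma certifiedI:
  assumes "finite T" "\<And>d u v. (d, u, v) \<in> T \<Longrightarrow> certified d u v"
    and "justified ((\<lambda>(d, u, v). triple d u v) ` T) c x y"
  shows "certified c x y"
proof -
  let ?tr = "\<lambda>(d, u, v). triple d u v"
  have "\<forall>t\<in>T. \<exists>A. finite A \<and> certificate A \<and> ?tr t \<in> A"
    using assms(2) unfolding certified_def by fast
  from bchoice[OF this] obtain F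
    where F: "\<forall>t\<in>T. finite (F t) \<and> certificate (F t) \<and> ?tr t \<in> F t" ..
  define A where "A = \<Union>(F ` T)"
  have fin: "finite A" using F assms(1) unfolding A_def by blast
  have cert: "certificate A" unfolding A_def by (rule certificate_Union) (use F in blast)
  have "?tr ` T \<subseteq> A" using F unfolding A_def by blast
  with assms(3) have "justified A c x y" by (rule justified_mono)
  then have "justified A d u v" if "triple d u v \<in> insert (triple c x y) A" for d u v
    using that cert unfolding certificate_def by (auto simp: triple_eq_iff)
  then have "certificate (insert (triple c x y) A)"
    unfolding certificate_def using justified_mono[OF _ subset_insertI] by simp
  then show ?thesis unfolding certified_def using fin
    by (intro exI[of _ "insert (triple c x y) A"]) simp
qed

lemma certificate_complete: "run c x = Some y \<Longrightarrow> certified c x y"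
proof (induction c arbitrary: x y)
  case (Pairing f g)
  then obtain a b where ab: "run f x = Some a" "run g x = Some b" "y = prod_encode (a, b)"
    by (auto simp: bind_eq_Some_conv)
  then show ?case using Pairing.IH by - (rule certifiedI[of "{(f, x, a), (g, x, b)}"], auto)
next
  case (Comp f g)
  then obtain a where "run g x = Some a" "run f a = Some y" by (auto simp: bind_eq_Some_conv)
  then show ?case using Comp.IH by - (rule certifiedI[of "{(g, x, a), (f, a, y)}"], auto)
next
  case (Prec f g)
  have "certified (Prec f g) x y" if "psnd x = m" "run (Prec f g) x = Some y" for m
    using that
  proof (induction m arbitrary: x y)
    case 0
    then have "run f (pfst x) = Some y" by (simp add: run_Prec_0 del: run.simps)
    then show ?case using 0 Prec.IH by - (rule certifiedI[of "{(f, pfst x, y)}"], auto)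
  next
    case (Suc m)
    then obtain v where v: "run (Prec f g) (prod_encode (pfst x, m)) = Some v"
      "run g (prod_encode (pfst x, prod_encode (m, v))) = Some y"
      unfolding run_Prec_Suc[OF Suc.prems(1)] by (auto simp: bind_eq_Some_conv simp del: run.simps)
    then have "certified (Prec f g) (prod_encode (pfst x, m)) v" using Suc.IH by (simp del: run.simps)
    then show ?case using Suc.prems v(2) Prec.IH
      by - (rule certifiedI[of "{(Prec f g, prod_encode (pfst x, m), v),
            (g, prod_encode (pfst x, prod_encode (m, v)), y)}"], auto)
  qed
  then show ?case using Prec.prems by blast
next
  case (Mu f)
  then have z: "run f (prod_encode (x, y)) = Some 0"
    and s: "\<forall>j<y. \<exists>v. run f (prod_encode (x, j)) = Some (Suc v)" unfolding run_Mu_iff by blast+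
  from s obtain h where h: "\<And>j. j < y \<Longrightarrow> run f (prod_encode (x, j)) = Some (Suc (h j))" by metis
  show ?case
    by (rule certifiedI[of "insert (f, prod_encode (x, y), 0) ((\<lambda>j. (f, prod_encode (x, j), Suc (h j))) ` {..<y})"])
      (use z h Mu.IH in \<open>auto simp: image_iff\<close>)
qed (rule certifiedI[of "{}"]; simp)+

section \<open>Arithmetized certificates and the normal form theorem\<close>

lemma less_if_mem_set_decode: "z \<in> set_decode D \<Longrightarrow> z < D"
proof -
  assume "z \<in> set_decode D"
  then have "D div 2 ^ z \<noteq> 0" unfolding set_decode_def by (auto intro: Nat.gr0I)
  then have "2 ^ z \<le> D" by (simp add: div_eq_0_iff)
  then show "z < D" using less_exp[of z] by linarith
qed

text \<open>Pairing dominates its components and a set code exceeds its elements; thus all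
  quantifiers over recorded facts can be bounded by D.\<close>

lemma triple_bounds: "triple c x y \<in> set_decode D \<Longrightarrow> number c < D \<and> x < D \<and> y < D"
  using less_if_mem_set_decode[of "triple c x y" D]
  unfolding triple_def by (meson le_less_trans le_prod_encode_1 le_prod_encode_2 le_trans)

definition triple_in :: "nat \<Rightarrow> nat \<Rightarrow> nat \<Rightarrow> nat \<Rightarrow> bool" where
  "triple_in D e x y \<longleftrightarrow> prod_encode (e, prod_encode (x, y)) \<in> set_decode D"

lemma decidable_triple_in [computable_intros]:
  assumes "computable f" "computable g" "computable h" "computable k"
  shows "decidable (\<lambda>n. triple_in (f n) (g n) (h n) (k n))"
  unfolding triple_in_def by (intro computable_intros assms)

text \<open>The constants 4 to 7 come from \<open>number\<close>. Subprograms have numbers below e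
  and recorded inputs and outputs lie below D, so every quantifier of \<open>justified\<close>
  becomes bounded.\<close>

definition justified_num :: "nat \<Rightarrow> nat \<Rightarrow> nat \<Rightarrow> nat \<Rightarrow> bool" where
  "justified_num D e x y \<longleftrightarrow>
     (e = 0 \<and> y = 0) \<or> (e = 1 \<and> y = Suc x) \<or> (e = 2 \<and> y = pfst x) \<or> (e = 3 \<and> y = psnd x) \<or>
     (\<exists>f<e. \<exists>g<e. e = 4 * prod_encode (f, g) + 4 \<and>
        (\<exists>a<D. \<exists>b<D. y = prod_encode (a, b) \<and> triple_in D f x a \<and> triple_in D g x b)) \<or>
     (\<exists>f<e. \<exists>g<e. e = 4 * prod_encode (f, g) + 5 \<and> (\<exists>a<D. triple_in D g x a \<and> triple_in D f a y)) \<or>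
     (\<exists>f<e. \<exists>g<e. e = 4 * prod_encode (f, g) + 6 \<and>
        (psnd x = 0 \<and> triple_in D f (pfst x) y \<or>
         psnd x \<noteq> 0 \<and> (\<exists>v<D. triple_in D e (prod_encode (pfst x, psnd x - 1)) v \<and>
                          triple_in D g (prod_encode (pfst x, prod_encode (psnd x - 1, v))) y))) \<or>
     (\<exists>f<e. e = 4 * f + 7 \<and> triple_in D f (prod_encode (x, y)) 0 \<and>
        (\<forall>j<y. \<exists>v<D. triple_in D f (prod_encode (x, j)) (Suc v)))"

lemma decidable_justified_num [computable_intros]:
  assumes "computable f" "computable g" "computable h" "computable k"
  shows "decidable (\<lambda>n. justified_num (f n) (g n) (h n) (k n))"
proof -
  have "decidable (\<lambda>n. justified_num (pfst n) (pfst (psnd n)) (pfst (psnd (psnd n))) (psnd (psnd (psnd n))))"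
    unfolding justified_num_def by (intro computable_intros)
  from decidable_comp[OF this, of "\<lambda>n. prod_encode (f n, prod_encode (g n, prod_encode (h n, k n)))"]
  show ?thesis by (simp add: computable_intros assms)
qed

lemma number_program: "number (program e) = e"
  unfolding program_def by (rule surj_f_inv_f) (rule bij_is_surj[OF bij_number])

lemma triple_program: "triple (program e) x y \<in> set_decode D \<longleftrightarrow> triple_in D e x y"
  by (simp add: triple_def triple_in_def number_program)

lemma justified_num_iff:
  "justified_num D (number c) x y \<longleftrightarrow> justified (set_decode D) c x y"
proof -
  have tr: "triple c x y \<in> set_decode D \<longleftrightarrow> triple_in D (number c) x y" for c x y
    by (simp add: triple_def triple_in_def)
  have bnd: "triple_in D e x y \<Longrightarrow> x < D \<and> y < D" for e x y
    using triple_bounds[of "program e" x y D] triple_program[of e] by blast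
  have sub: "f < 4 * prod_encode (f, g) + k" "g < 4 * prod_encode (f, g) + k" if "0 < k" for f g k :: nat
    using le_prod_encode_1[of f g] le_prod_encode_2[of g f] that by linarith+
  \<comment> \<open>The four offsets differ modulo 4, so at most one clause can apply to a given
    number.\<close>
  have ne: "4 * p + 4 \<noteq> 4 * q + 5" "4 * p + 4 \<noteq> 4 * q + 6" "4 * p + 4 \<noteq> 4 * q + 7"
     "4 * p + 5 \<noteq> 4 * q + 6" "4 * p + 5 \<noteq> 4 * q + 7" "4 * p + 6 \<noteq> 4 * q + 7" for p q :: nat
    by presburger+
  show ?thesis
  proof (cases c)
    case (Pairing f g)
    then have "justified_num D (number c) x y \<longleftrightarrow>
      (\<exists>a<D. \<exists>b<D. y = prod_encode (a, b) \<and> triple_in D (number f) x a \<and> triple_in D (number g) x b)"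
      using sub(1)[of 4 "number f" "number g"] sub(2)[of 4 "number g" "number f"] by (simp add: justified_num_def ne prod_encode_eq)
    then show ?thesis using bnd Pairing by (auto simp: tr)
  next
    case (Comp f g)
    then have "justified_num D (number c) x y \<longleftrightarrow>
      (\<exists>a<D. triple_in D (number g) x a \<and> triple_in D (number f) a y)"
      using sub(1)[of 5 "number f" "number g"] sub(2)[of 5 "number g" "number f"] by (simp add: justified_num_def ne ne[symmetric] prod_encode_eq)
    then show ?thesis using bnd Comp by (auto simp: tr)
  next
    case (Prec f g)
    then have "justified_num D (number c) x y \<longleftrightarrow>
       psnd x = 0 \<and> triple_in D (number f) (pfst x) y \<or>
         psnd x \<noteq> 0 \<and> (\<exists>v<D. triple_in D (number c) (prod_encode (pfst x, psnd x - 1)) v \<and>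
           triple_in D (number g) (prod_encode (pfst x, prod_encode (psnd x - 1, v))) y)"
      using sub(1)[of 6 "number f" "number g"] sub(2)[of 6 "number g" "number f"] by (simp add: justified_num_def ne ne[symmetric] prod_encode_eq)
    then show ?thesis using bnd Prec by (cases "psnd x") (auto simp: tr simp del: number.simps)
  next
    case (Mu f)
    then have "justified_num D (number c) x y \<longleftrightarrow> triple_in D (number f) (prod_encode (x, y)) 0 \<and>
        (\<forall>j<y. \<exists>v<D. triple_in D (number f) (prod_encode (x, j)) (Suc v))"
      by (simp add: justified_num_def ne ne[symmetric])
    moreover have "(\<exists>v<D. triple_in D e u (Suc v)) \<longleftrightarrow> (\<exists>v. triple_in D e u (Suc v))" for e u
      using bnd Suc_lessD by blast
    ultimately show ?thesis using Mu by (simp add: tr)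
  qed (simp_all add: justified_num_def)
qed

definition certifies :: "nat \<Rightarrow> nat \<Rightarrow> nat \<Rightarrow> nat \<Rightarrow> bool" where
  "certifies D e x y \<longleftrightarrow> triple_in D e x y \<and>
     (\<forall>d<D. \<forall>u<D. \<forall>v<D. triple_in D d u v \<longrightarrow> justified_num D d u v)"

lemma decidable_certifies [computable_intros]:
  assumes "computable f" "computable g" "computable h" "computable k"
  shows "decidable (\<lambda>n. certifies (f n) (g n) (h n) (k n))"
proof -
  have "decidable (\<lambda>n. certifies (pfst n) (pfst (psnd n)) (pfst (psnd (psnd n))) (psnd (psnd (psnd n))))"
    unfolding certifies_def by (intro computable_intros)
  from decidable_comp[OF this, of "\<lambda>n. prod_encode (f n, prod_encode (g n, prod_encode (h n, k n)))"]
  show ?thesis by (simp add: computable_intros assms)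
qed

lemma certifies_iff:
  "certifies D e x y \<longleftrightarrow> triple (program e) x y \<in> set_decode D \<and> certificate (set_decode D)"
proof -
  have "(\<forall>d<D. \<forall>u<D. \<forall>v<D. triple_in D d u v \<longrightarrow> justified_num D d u v) \<longleftrightarrow>
      (\<forall>c u v. triple c u v \<in> set_decode D \<longrightarrow> justified (set_decode D) c u v)" (is "?l \<longleftrightarrow> ?r")
  proof
    assume l: ?l
    show ?r
    proof (intro allI impI)
      fix c u v assume c: "triple c u v \<in> set_decode D"
      then have "triple_in D (number c) u v" by (simp add: triple_def triple_in_def)
      then show "justified (set_decode D) c u v"
        using l triple_bounds[OF c] by (simp add: justified_num_iff[symmetric])
    qed
  next
    assume r: ?r
    show ?l
    proof (intro allI impI)
      fix d u v assume "triple_in D d u v"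
      then have "triple (program d) u v \<in> set_decode D" by (simp add: triple_program)
      then have "justified (set_decode D) (program d) u v" using r by blast
      then show "justified_num D d u v" using justified_num_iff[of D "program d"] by (simp add: number_program)
    qed
  qed
  then show ?thesis unfolding certifies_def certificate_def triple_program by blast
qed

text \<open>Kleene's normal form theorem, with \<open>certifies\<close> as the decidable
  T-predicate.\<close>

lemma Phi_iff_certifies: "Phi e x = Some y \<longleftrightarrow> (\<exists>D. certifies D e x y)"
proof
  assume "Phi e x = Some y"
  then obtain A where "finite A" "certificate A" "triple (program e) x y \<in> A"
    using certificate_complete unfolding Phi_def certified_def by blast
  then show "\<exists>D. certifies D e x y"
    by (intro exI[of _ "set_encode A"]) (simp add: certifies_iff)
next
  assume "\<exists>D. certifies D e x y"
  then show "Phi e x = Some y" unfolding Phi_def certifies_iff using certificate_sound by blast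
qed

lemma certifies_less: "certifies D e x y \<Longrightarrow> y < D"
  unfolding certifies_iff using triple_bounds by blast

section \<open>Kleene-Brouwer orders\<close>

text \<open>Well-foundedness in the form of bar induction, so that properties pass from the
  immediate subtrees to the tree.\<close>

inductive well_founded_tree :: "nat list set \<Rightarrow> bool" where
  empty: "well_founded_tree {}"
| children: "(\<And>x. well_founded_tree {xs. x # xs \<in> T}) \<Longrightarrow> well_founded_tree T"

abbreviation descending :: "nat rel" where "descending \<equiv> {(a, b). b < a}"

text \<open>In \<open>lexord\<close> a proper prefix is smaller. Swapping the pair makes extensions
  smaller, and the reversed relation on entries undoes the swap there: at the first difference the
  smaller entry wins.\<close>

definition strict_kb :: "nat list set \<Rightarrow> nat list rel" where
  "strict_kb T = {(xs, ys). xs \<in> T \<and> ys \<in> T \<and> (ys, xs) \<in> lexord descending}"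

text \<open>What precedes \<open>x # xs\<close> lies in the subtree of a smaller sibling, handled by
  induction on x, or earlier in the same subtree, handled by the hypothesis. The root comes after
  all other nodes.\<close>

lemma wf_strict_kb: "well_founded_tree T \<Longrightarrow> wf (strict_kb T)"
proof (induction T rule: well_founded_tree.induct)
  case empty
  show ?case by (simp add: strict_kb_def)
next
  case (children T)
  have cons: "x # xs \<in> Wellfounded.acc (strict_kb T)" for x xs
  proof (induction x arbitrary: xs rule: less_induct)
    case (less x)
    show ?case
    proof (induction xs rule: wf_induct_rule[OF children.IH[of x]])
      case (1 xs)
      show ?case
      proof (rule accI)
        fix zs assume "(zs, x # xs) \<in> strict_kb T"
        then obtain z zs' where "zs = z # zs'" "z < x \<or> z = x \<and> (zs', xs) \<in> strict_kb {xs. x # xs \<in> T}"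
          unfolding strict_kb_def by (cases zs) auto
        then show "zs \<in> Wellfounded.acc (strict_kb T)" using less.IH 1 by blast
      qed
    qed
  qed
  have "xs \<in> Wellfounded.acc (strict_kb T)" for xs
  proof (cases xs)
    case Nil
    have "zs \<in> Wellfounded.acc (strict_kb T)" if "(zs, []) \<in> strict_kb T" for zs
      using that cons by (cases zs) (auto simp: strict_kb_def)
    then show ?thesis unfolding Nil by (rule accI)
  qed (simp add: cons)
  then show ?case by (simp add: wf_iff_acc)
qed

text \<open>An ill-founded tree has an ill-founded immediate subtree. Choosing one repeatedly yields
  a path, and it stays in \<open>T\<close> because ill-founded subtrees are nonempty and
  \<open>T\<close> is closed under prefixes.\<close>

lemma well_founded_treeI:
  assumes closed: "\<And>xs ys. xs @ ys \<in> T \<Longrightarrow> xs \<in> T"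
    and no_path: "\<And>f. \<exists>n. map f [0..<n] \<notin> T"
  shows "well_founded_tree T"
proof (rule ccontr)
  assume T: "\<not> well_founded_tree T"
  define child where "child S = (SOME x. \<not> well_founded_tree {xs. x # xs \<in> S})" for S :: "nat list set"
  define sub where "sub n = rec_nat T (\<lambda>_ S. {xs. child S # xs \<in> S}) n" for n
  define f where "f n = child (sub n)" for n
  have step: "\<not> well_founded_tree {xs. child S # xs \<in> S}" if "\<not> well_founded_tree S" for S
  proof -
    have "\<exists>x. \<not> well_founded_tree {xs. x # xs \<in> S}" using that well_founded_tree.children by blast
    then show ?thesis unfolding child_def by (rule someI_ex)
  qed
  have nwf: "\<not> well_founded_tree (sub n)" for n
  proof (induction n)
    case 0
    then show ?case using T by (simp add: sub_def)
  next
    case (Suc n)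
    then show ?case using step[of "sub n"] by (simp add: sub_def)
  qed
  have sub_eq: "sub n = {xs. map f [0..<n] @ xs \<in> T}" for n
  proof (induction n)
    case 0
    show ?case by (simp add: sub_def)
  next
    case (Suc n)
    have "sub (Suc n) = {xs. f n # xs \<in> sub n}" by (simp add: sub_def f_def)
    then show ?case using Suc by simp
  qed
  have "map f [0..<n] \<in> T" for n
  proof -
    have "sub n \<noteq> {}" using nwf[of n] well_founded_tree.empty by auto
    then show ?thesis using sub_eq[of n] closed by blast
  qed
  then show False using no_path by blast
qed

definition kb_order :: "nat list set \<Rightarrow> nat rel" where
  "kb_order T = {(m, n). list_decode m \<in> T \<and> list_decode n \<in> T \<and>
     (m = n \<or> (list_decode n, list_decode m) \<in> lexord descending)}"

lemma Field_kb_order: "Field (kb_order T) = {n. list_decode n \<in> T}"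
  by (auto simp: kb_order_def Field_def)

lemma trans_descending: "trans descending"
  by (auto simp: trans_def)

lemma Well_order_kb_order:
  assumes "well_founded_tree T"
  shows "Well_order (kb_order T)"
proof -
  have asym: "(ys, xs) \<notin> lexord descending" if "(xs, ys) \<in> lexord descending" for xs ys
    using that lexord_trans[OF _ _ trans_descending, of xs ys xs] lexord_irreflexive[of descending xs] by auto
  have "refl_on (Field (kb_order T)) (kb_order T)"
    unfolding Field_kb_order by (auto simp: refl_on_def kb_order_def)
  moreover have "trans (kb_order T)"
    using lexord_trans[OF _ _ trans_descending] unfolding kb_order_def trans_def by blast
  moreover have "antisym (kb_order T)"
    using asym unfolding kb_order_def antisym_def by blast
  moreover have "total_on (Field (kb_order T)) (kb_order T)"
  proof (rule total_onI)
    fix m n assume *: "m \<in> Field (kb_order T)" "n \<in> Field (kb_order T)" "m \<noteq> n"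
    then have "list_decode m \<noteq> list_decode n" by (simp add: list_decode_eq)
    then have "(list_decode m, list_decode n) \<in> lexord descending \<or> (list_decode n, list_decode m) \<in> lexord descending"
      using lexord_linear[of descending "list_decode m" "list_decode n"] by fastforce
    then show "(m, n) \<in> kb_order T \<or> (n, m) \<in> kb_order T"
      using * unfolding Field_kb_order by (auto simp: kb_order_def)
  qed
  moreover have "wf (kb_order T - Id)"
    by (rule wf_subset[OF wf_inv_image[OF wf_strict_kb[OF assms], of list_decode]])
      (auto simp: kb_order_def strict_kb_def inv_image_def)
  ultimately show ?thesis unfolding order_on_defs by (auto simp: Field_def)
qed

text \<open>Phrased by indices, the order involves only bounded quantifiers.\<close>

lemma lexord_nth_conv:
  "(xs, ys) \<in> lexord r \<longleftrightarrow>
     (length xs < length ys \<and> (\<forall>j<length xs. xs ! j = ys ! j)) \<or>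
     (\<exists>i<length xs. i < length ys \<and> (\<forall>j<i. xs ! j = ys ! j) \<and> (xs ! i, ys ! i) \<in> r)"
proof -
  have "take i xs = take i ys \<longleftrightarrow> (\<forall>j<i. xs ! j = ys ! j)" if "i \<le> length xs" "i \<le> length ys" for i
    using that by (auto simp: list_eq_iff_nth_eq)
  from this[of "length xs"] this show ?thesis
    unfolding lexord_take_index_conv by (auto simp: eq_commute[of "take (length xs) ys"])
qed

lemma decidable_lexord_descending [computable_intros]:
  assumes "computable f" "computable g"
  shows "decidable (\<lambda>n. (list_decode (f n), list_decode (g n)) \<in> lexord descending)"
proof -
  have *: "(list_decode m, list_decode n) \<in> lexord descending \<longleftrightarrow>
     (length (list_decode m) < length (list_decode n) \<and>
       (\<forall>j<length (list_decode m). code_nth m j = code_nth n j)) \<or>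
     (\<exists>i<length (list_decode m). i < length (list_decode n) \<and>
       (\<forall>j<i. code_nth m j = code_nth n j) \<and> code_nth n i < code_nth m i)" for m n
    unfolding lexord_nth_conv by (simp add: list_decode_nth cong: conj_cong imp_cong)
  have "decidable (\<lambda>z. (list_decode (pfst z), list_decode (psnd z)) \<in> lexord descending)"
    unfolding * by (intro computable_intros)
  from decidable_comp[OF this computable_pair[OF assms]] show ?thesis by simp
qed

lemma computable_rel_kb_order:
  assumes "decidable (\<lambda>n. list_decode n \<in> T)"
  shows "computable_rel (kb_order T)"
proof (rule computable_relI)
  have "decidable (\<lambda>n. list_decode (pfst n) \<in> T \<and> list_decode (psnd n) \<in> T \<and>
      (pfst n = psnd n \<or> (list_decode (psnd n), list_decode (pfst n)) \<in> lexord descending))"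
    by (intro computable_intros decidable_comp[OF assms])
  then show "decidable (\<lambda>n. (pfst n, psnd n) \<in> kb_order T)" by (simp add: kb_order_def case_prod_beta)
qed

section \<open>The decidable tree of a pair of terms\<close>

definition code_opt :: "nat option \<Rightarrow> nat" where
  "code_opt z = (case z of None \<Rightarrow> 0 | Some v \<Rightarrow> Suc v)"

lemma code_opt_simps [simp]: "code_opt None = 0" "code_opt (Some v) = Suc v"
  by (simp_all add: code_opt_def)

lemma code_opt_eq_iff: "code_opt y = code_opt z \<longleftrightarrow> y = z"
  by (cases y; cases z) simp_all

text \<open>
  Here \<open>p\<close> and \<open>q\<close> code optional values, and \<open>q\<close> is claimed to be the result of applying \<open>p\<close>
  to \<open>x\<close>. That it is defined is witnessed by the certificate \<open>D\<close>; that it is undefined cannot be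
  witnessed, and is only tested against the certificates below \<open>n\<close>.
\<close>

definition claim :: "nat \<Rightarrow> nat \<Rightarrow> nat \<Rightarrow> nat \<Rightarrow> nat \<Rightarrow> bool" where
  "claim n p x q D \<longleftrightarrow>
     (q = 0 \<and> (p = 0 \<or> (\<forall>E<n. \<forall>v<E. \<not> certifies E (p - 1) x v))) \<or>
     (q \<noteq> 0 \<and> p \<noteq> 0 \<and> certifies D (p - 1) x (q - 1))"

lemma decidable_claim [computable_intros]:
  assumes "computable f1" "computable f2" "computable f3" "computable f4" "computable f5"
  shows "decidable (\<lambda>n. claim (f1 n) (f2 n) (f3 n) (f4 n) (f5 n))"
proof -
  let ?p1 = pfst and ?p2 = "\<lambda>n. pfst (psnd n)" and ?p3 = "\<lambda>n. pfst (psnd (psnd n))"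
    and ?p4 = "\<lambda>n. pfst (psnd (psnd (psnd n)))" and ?p5 = "\<lambda>n. psnd (psnd (psnd (psnd n)))"
  have "decidable (\<lambda>n. claim (?p1 n) (?p2 n) (?p3 n) (?p4 n) (?p5 n))"
    unfolding claim_def by (intro computable_intros)
  from decidable_comp[OF this, of "\<lambda>n. prod_encode (f1 n, prod_encode (f2 n,
      prod_encode (f3 n, prod_encode (f4 n, f5 n))))"]
  show ?thesis by (simp add: computable_intros assms)
qed

text \<open>A longer search refutes more claims. Hence the tree below is closed under
  prefixes.\<close>

lemma claim_antimono: "claim n p x q D \<Longrightarrow> m \<le> n \<Longrightarrow> claim m p x q D"
  unfolding claim_def by (meson less_le_trans)

abbreviation app_opt :: "nat option \<Rightarrow> nat \<Rightarrow> nat option" where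
  "app_opt z x \<equiv> Option.bind z (\<lambda>e. K1 e x)"

text \<open>One D must serve all n, because the entry stays in place while the sequence and with it
  the test bound grow.\<close>

lemma claim_complete: "\<exists>D. \<forall>n. claim n (code_opt z) x (code_opt (app_opt z x)) D"
proof (cases z)
  case None
  then show ?thesis by (simp add: claim_def)
next
  case (Some e)
  show ?thesis
  proof (cases "K1 e x")
    case None
    then have "\<not> certifies E e x v" for E v using Phi_iff_certifies[of e x v] by (auto simp: K1_def)
    then show ?thesis using Some None by (simp add: claim_def)
  next
    case (Some v)
    then obtain D where "certifies D e x v" using Phi_iff_certifies[of e x v] by (auto simp: K1_def)
    then show ?thesis using \<open>z = Some e\<close> Some by (auto simp: claim_def)
  qed
qed

lemma claim_sound:
  assumes "\<And>n. claim n (code_opt z) x q D"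
  shows "q = code_opt (app_opt z x)"
proof (cases q)
  case 0
  have "app_opt z x = None"
  proof (rule ccontr)
    assume "app_opt z x \<noteq> None"
    then obtain e v where ev: "z = Some e" "Phi e x = Some v" by (cases z) (auto simp: K1_def)
    then obtain E where "certifies E e x v" using Phi_iff_certifies by blast
    moreover from this have "v < E" by (rule certifies_less)
    \<comment> \<open>The bound \<open>Suc E\<close> is the first that includes the refuting
      certificate, and its value is found since it is below E.\<close>
    ultimately show False using assms[of "Suc E"] ev(1) 0 by (auto simp: claim_def)
  qed
  then show ?thesis using 0 by simp
next
  case (Suc v)
  then have "z \<noteq> None" using assms[of 0] by (cases z) (simp_all add: claim_def)
  then obtain e where e: "z = Some e" by blast
  then have "certifies D e x v" using assms[of 0] Suc by (simp add: claim_def)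
  then have "Phi e x = Some v" using Phi_iff_certifies by blast
  then show ?thesis using e Suc by (simp add: K1_def)
qed

abbreviation arg :: "nat \<Rightarrow> nat" where "arg c \<equiv> pfst c"
abbreviation left_value :: "nat \<Rightarrow> nat" where "left_value c \<equiv> pfst (psnd c)"
abbreviation right_value :: "nat \<Rightarrow> nat" where "right_value c \<equiv> pfst (psnd (psnd c))"
abbreviation left_cert :: "nat \<Rightarrow> nat" where "left_cert c \<equiv> pfst (psnd (psnd (psnd c)))"
abbreviation right_cert :: "nat \<Rightarrow> nat" where "right_cert c \<equiv> psnd (psnd (psnd (psnd c)))"

definition step :: "nat \<Rightarrow> nat \<Rightarrow> nat \<Rightarrow> bool" where
  "step n p c \<longleftrightarrow> claim n (left_value p) (arg c) (left_value c) (left_cert c) \<and>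
     claim n (right_value p) (arg c) (right_value c) (right_cert c) \<and>
     left_value c \<noteq> right_value c"

lemma step_antimono: "step n p c \<Longrightarrow> m \<le> n \<Longrightarrow> step m p c"
  unfolding step_def using claim_antimono by blast

text \<open>
  The length of the sequence bounds the search for certificates, so that membership is decidable,
  while along an infinite path all claims of undefinedness are true.
\<close>

definition step_tree :: "nat \<Rightarrow> nat list set" where
  "step_tree p = {cs. successively (step (length cs)) (p # cs)}"

lemma step_tree_prefix: "cs @ ds \<in> step_tree p \<Longrightarrow> cs \<in> step_tree p"
proof -
  assume "cs @ ds \<in> step_tree p"
  then have "successively (step (length (cs @ ds))) ((p # cs) @ ds)" by (simp add: step_tree_def)
  then have "successively (step (length (cs @ ds))) (p # cs)" unfolding successively_append_iff by blast
  then show ?thesis unfolding step_tree_def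
    by (auto elim!: successively_mono intro: step_antimono)
qed

lemma decidable_step_tree: "decidable (\<lambda>n. list_decode n \<in> step_tree p)"
proof -
  \<comment> \<open>The number \<open>Suc (prod_encode (p, n))\<close> codes the list with p put in
    front, so entry i there is the predecessor of entry i of the sequence.\<close>
  have "list_decode n \<in> step_tree p \<longleftrightarrow>
      (\<forall>i<length (list_decode n). step (length (list_decode n))
         (code_nth (Suc (prod_encode (p, n))) i) (code_nth n i))" for n
  proof -
    have "code_nth (Suc (prod_encode (p, n))) i = (p # list_decode n) ! i"
      if "i < length (list_decode n)" for i
      using list_decode_nth[of i "Suc (prod_encode (p, n))"] that by simp
    then show ?thesis unfolding step_tree_def successively_conv_nth by (simp add: list_decode_nth)
  qed
  moreover have "decidable (\<lambda>n. \<forall>i<length (list_decode n). step (length (list_decode n))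
         (code_nth (Suc (prod_encode (p, n))) i) (code_nth n i))"
    unfolding step_def by (intro computable_intros)
  ultimately show ?thesis by simp
qed

text \<open>A root entry in the layout of a node; only its two values are ever read, and the zeros
  fill the places of argument and certificates.\<close>

definition start :: "nat closed_term \<Rightarrow> nat closed_term \<Rightarrow> nat" where
  "start s t = prod_encode (0, prod_encode (code_opt (value_of K1 s),
     prod_encode (code_opt (value_of K1 t), 0)))"

abbreviation app_elems :: "'a closed_term \<Rightarrow> 'a list \<Rightarrow> 'a closed_term" where
  "app_elems s xs \<equiv> foldl (\<lambda>u x. App u (Elem x)) s xs"

text \<open>On an infinite path every claim is tested at every bound, so by
  \<open>claim_sound\<close> the recorded values are the true ones. The arguments on the path would
  then keep the terms different forever.\<close>

lemma well_founded_step_tree: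
  assumes "Well_order r" "sim K1 r s t" "\<not> kleene_eq K1 s t"
  shows "well_founded_tree (step_tree (start s t))"
proof (rule well_founded_treeI)
  fix f :: "nat \<Rightarrow> nat"
  show "\<exists>n. map f [0..<n] \<notin> step_tree (start s t)"
  proof (rule ccontr)
    assume "\<nexists>n. map f [0..<n] \<notin> step_tree (start s t)"
    then have T: "successively (step n) (start s t # map f [0..<n])" for n
      by (simp add: step_tree_def)
    define prev where "prev i = (case i of 0 \<Rightarrow> start s t | Suc j \<Rightarrow> f j)" for i
    have st: "step n (prev i) (f i)" for n i
    proof (rule step_antimono)
      \<comment> \<open>A prefix long enough both to contain entry i and to test it at bound
        n.\<close>
      let ?m = "Suc (n + i)"
      have "step ?m ((start s t # map f [0..<?m]) ! i) ((start s t # map f [0..<?m]) ! Suc i)"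
        by (rule successively_nth[OF T]) simp
      then show "step ?m (prev i) (f i)"
        by (cases i) (simp_all add: prev_def del: upt_Suc)
    qed simp
    define xs where "xs i = map (\<lambda>j. arg (f j)) [0..<i]" for i
    have val: "left_value (prev i) = code_opt (value_of K1 (app_elems s (xs i))) \<and>
        right_value (prev i) = code_opt (value_of K1 (app_elems t (xs i)))" for i
    proof (induction i)
      case 0
      show ?case by (simp add: prev_def xs_def start_def)
    next
      case (Suc i)
      have "claim n (left_value (prev i)) (arg (f i)) (left_value (f i)) (left_cert (f i))"
        "claim n (right_value (prev i)) (arg (f i)) (right_value (f i)) (right_cert (f i))" for n
        using st[of n i] by (simp_all add: step_def)
      with Suc have
        "left_value (f i) = code_opt (app_opt (value_of K1 (app_elems s (xs i))) (arg (f i)))"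
        "right_value (f i) = code_opt (app_opt (value_of K1 (app_elems t (xs i))) (arg (f i)))"
        by (metis claim_sound)+
      then show ?case by (simp add: prev_def xs_def)
    qed
    have "\<not> kleene_eq K1 (app_elems s (xs i)) (app_elems t (xs i))" for i
    \<comment> \<open>No step compares the values of the root, so their difference comes from the
      assumption on s and t.\<close>
    proof (cases i)
      case 0
      then show ?thesis using assms(3) by (simp add: xs_def)
    next
      case (Suc j)
      have "left_value (prev i) \<noteq> right_value (prev i)"
        using st[of 0 j] Suc by (simp add: prev_def step_def)
      then show ?thesis using val[of i] by (simp add: kleene_eq_def code_opt_eq_iff)
    qed
    then show False using sim_eventually_kleene_eq[OF assms(1,2), of "\<lambda>j. arg (f j)"]
      unfolding xs_def by blast
  qed
qed (rule step_tree_prefix)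

text \<open>Induction along the order, over the nodes that pass the test at every bound and record
  the true values of s' and t'. If applying both to x gives different results, the node has a
  truthful extension by x, which is smaller and serves as the witness for
  \<open>sim_iff\<close>.\<close>

lemma sim_kb_order_step_tree:
  assumes "well_founded_tree (step_tree (start s t))"
  shows "sim K1 (kb_order (step_tree (start s t))) s t"
proof -
  define T where "T = step_tree (start s t)"
  define r where "r = kb_order T"
  have wo: "Well_order r" unfolding r_def T_def using assms by (rule Well_order_kb_order)
  have wf: "wf (r - Id)" using wo unfolding order_on_defs by blast
  have node: "list_encode cs \<in> Field r" if "\<And>n. successively (step n) (start s t # cs)" for cs
    using that unfolding r_def Field_kb_order T_def step_tree_def by simp
  have "sim K1 (below r (list_encode cs)) (App s' (Elem x)) (App t' (Elem x))"
    if "\<And>n. successively (step n) (start s t # cs)"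
      "left_value (last (start s t # cs)) = code_opt (value_of K1 s')"
      "right_value (last (start s t # cs)) = code_opt (value_of K1 t')" for cs s' t' x
    using that
  proof (induction "list_encode cs" arbitrary: cs s' t' x rule: wf_induct_rule[OF wf])
    case (1 cs)
    show ?case
    proof (cases "kleene_eq K1 (App s' (Elem x)) (App t' (Elem x))")
      case True
      then show ?thesis using sim_iff Well_order_below[OF wo] by metis
    next
      case False
      obtain D E where DE: "\<And>n. claim n (code_opt (value_of K1 s')) x (code_opt (app_opt (value_of K1 s') x)) D"
        "\<And>n. claim n (code_opt (value_of K1 t')) x (code_opt (app_opt (value_of K1 t') x)) E"
        using claim_complete by metis
      \<comment> \<open>The truthful entry for x: the actual values together with certificates valid
        at every bound.\<close>
      define c where "c = prod_encode (x, prod_encode (code_opt (value_of K1 (App s' (Elem x))),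
        prod_encode (code_opt (value_of K1 (App t' (Elem x))), prod_encode (D, E))))"
      have "step n (last (start s t # cs)) c" for n
        unfolding step_def "1.prems" c_def using DE False by (simp add: kleene_eq_def code_opt_eq_iff)
      then have cs: "successively (step n) (start s t # cs @ [c])" for n
        using "1.prems"(1)[of n] successively_append_iff[of "step n" "start s t # cs" "[c]"] by simp
      have "(list_encode (cs @ [c]), list_encode cs) \<in> r"
        using node[OF cs] node[OF "1.prems"(1)] unfolding r_def Field_kb_order
        by (simp add: kb_order_def lexord_append_rightI)
      moreover have "list_encode (cs @ [c]) \<noteq> list_encode cs" by (simp only: list_encode_eq) simp
      ultimately have lt: "(list_encode (cs @ [c]), list_encode cs) \<in> r - Id" by blast
      have "\<forall>y. sim K1 (below r (list_encode (cs @ [c]))) (App (App s' (Elem x)) (Elem y)) (App (App t' (Elem x)) (Elem y))"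
      proof
        fix y
        show "sim K1 (below r (list_encode (cs @ [c]))) (App (App s' (Elem x)) (Elem y)) (App (App t' (Elem x)) (Elem y))"
          by (rule "1.hyps"[OF lt cs]) (simp_all add: c_def)
      qed
      moreover have "list_encode (cs @ [c]) \<in> Field (below r (list_encode cs))"
        using lt by (simp add: Field_below[OF wo] underS_def)
      moreover have "below (below r (list_encode cs)) (list_encode (cs @ [c])) = below r (list_encode (cs @ [c]))"
        using lt by (intro below_below[OF wo]) simp_all
      ultimately show ?thesis using sim_iff[OF Well_order_below[OF wo]] by metis
    qed
  qed
  \<comment> \<open>The statement at a node concerns one further argument, so at the root it is
    exactly what \<open>sim_iff\<close> asks of the root as witness for s and t.\<close>
  from this[of "[]" s t] have "sim K1 (below r (list_encode [])) (App s (Elem x)) (App t (Elem x))" for x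
    by (simp add: start_def)
  moreover have "list_encode [] \<in> Field r" by (rule node) simp
  ultimately show ?thesis unfolding r_def[symmetric] T_def[symmetric] using sim_iff[OF wo] by blast
qed

lemma sim_K1_computable:
  assumes "Well_order r" "sim K1 r s t"
  shows "\<exists>q :: nat rel. q <o omega1CK \<and> sim K1 q s t"
proof (cases "kleene_eq K1 s t")
  case True
  have "decidable (\<lambda>n. (pfst n, psnd n) \<in> {})" by (simp add: computable_intros)
  then have "({} :: nat rel) <o omega1CK"
    by (intro computable_Well_order_ordLess_omega1CK computable_relI) simp_all
  then show ?thesis using True sim_zero_iff by blast
next
  case False
  define T where "T = step_tree (start s t)"
  have T: "well_founded_tree T" unfolding T_def using assms False by (rule well_founded_step_tree)
  have "kb_order T <o omega1CK"
    by (intro computable_Well_order_ordLess_omega1CK Well_order_kb_order T computable_rel_kb_order)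
      (simp add: T_def decidable_step_tree)
  moreover have "sim K1 (kb_order T) s t"
    using T unfolding T_def by (rule sim_kb_order_step_tree)
  ultimately show ?thesis by blast
qed

section \<open>The closure ordinal\<close>

lemma Well_order_osucc:
  assumes "Well_order r"
  shows "Well_order (osucc r)"
proof -
  have r: "refl_on (Field r) r" "trans r" "antisym r" "total_on (Field r) r" "wf (r - Id)"
    using assms unfolding order_on_defs by blast+
  have F: "Field (osucc r) = insert None (Some ` Field r)"
  proof
    have "(x, None) \<in> osucc r" if "x \<in> insert None (Some ` Field r)" for x
      using that by (simp add: osucc_def)
    then show "insert None (Some ` Field r) \<subseteq> Field (osucc r)" by (blast intro: FieldI1)
  qed (auto simp: Field_def osucc_def)
  have "refl_on (Field (osucc r)) (osucc r)"
    using r(1) unfolding F by (auto simp: refl_on_def osucc_def)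
  moreover have "trans (osucc r)"
    using r(2) by (auto simp: trans_def osucc_def Field_def)
  moreover have "antisym (osucc r)"
    using r(3) by (auto simp: antisym_def osucc_def)
  moreover have "total_on (Field (osucc r)) (osucc r)"
    using r(4) unfolding F by (auto simp: total_on_def osucc_def)
  moreover have "wf (osucc r - Id)"
  proof -
    have "wf (map_prod Some Some ` (r - Id))" using r(5) by (rule wf_map_prod_image) simp
    moreover have "wf {(Some a, None) | a. True}"
      by (rule wf_subset[OF wf_measure[of "case_option (1::nat) (\<lambda>_. 0)"]]) auto
    ultimately have "wf (map_prod Some Some ` (r - Id) \<union> {(Some a, None) | a. True})"
      by (rule wf_Un) auto
    then show ?thesis by (rule wf_subset) (auto simp: osucc_def)
  qed
  ultimately show ?thesis unfolding order_on_defs by (auto simp: Field_def)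
qed

lemma sim_osucc:
  assumes "Well_order r" "sim app r s t"
  shows "sim app (osucc r) s t"
proof (rule sim_mono_fun[OF assms(1) Well_order_osucc[OF assms(1)] _ _ assms(2)])
  have "(Some a, None) \<in> osucc r" if "a \<in> Field r" for a using that by (simp add: osucc_def)
  then show "Some ` Field r \<subseteq> Field (osucc r)" by (blast intro: FieldI1)
qed (simp add: osucc_def)

text \<open>A pair related at the successor is related at some ordinal below
  \<open>omega1CK\<close>, hence at \<open>omega1CK\<close> by monotonicity.\<close>

lemma sim_omega1CK_stable: "sim K1 omega1CK = sim K1 (osucc omega1CK)"
proof (intro ext iffI)
  fix s t
  assume "sim K1 omega1CK s t"
  then show "sim K1 (osucc omega1CK) s t" by (rule sim_osucc[OF Well_order_omega1CK])
next
  fix s t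
  assume "sim K1 (osucc omega1CK) s t"
  from sim_K1_computable[OF Well_order_osucc[OF Well_order_omega1CK] this]
  obtain q :: "nat rel" where "q <o omega1CK" "sim K1 q s t" by blast
  then show "sim K1 omega1CK s t" using sim_mono ordLess_imp_ordLeq by blast
qed

text \<open>Stability at \<open>omega1CK\<close> is used twice: it provides a candidate for the
  choice of the least stable order, and it bounds that order by minimality.\<close>

lemma pca_ord_K1: "pca_ord K1 \<le>o omega1CK"
proof -
  have "\<exists>r :: nat rel. is_least_stable K1 r"
    unfolding is_least_stable_def
    using ex_least_Well_order[of omega1CK "\<lambda>r. sim K1 r = sim K1 (osucc r)",
        OF Well_order_omega1CK sim_omega1CK_stable] by simp
  then have "is_least_stable K1 (pca_ord K1)" unfolding pca_ord_def by (rule someI_ex)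
  then show ?thesis
    unfolding is_least_stable_def using Well_order_omega1CK sim_omega1CK_stable by blast
qed

theorem theorem5p4:
  fixes \<alpha> :: "'o rel"
  shows "(\<forall>s t :: nat closed_term. Well_order \<alpha> \<and> sim K1 \<alpha> s t \<longrightarrow>
            (\<exists>\<beta> :: nat rel. \<beta> <o omega1CK \<and> sim K1 \<beta> s t))
         \<and> pca_ord K1 \<le>o omega1CK"
  using sim_K1_computable pca_ord_K1 by blast

end
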